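(* For any operator spaces $V$ and $W$, the space $\mathcal{H}^\infty_{\mathrm{cb}}(B_V,W)$ of completely bounded holomorphic functions, endowed with the matrix norms $$\|(f_{k\ell})\|_{M_n(\mathcal{H}^\infty_{\mathrm{cb}}(B_V,W))}=\sup\{\|(f_{k\ell}(x_{ij}))\|_{M_{mn}(W)} : m\in\mathbb N,\ (x_{ij})\in B_{M_m(V)}\},$$ is an operator space (in particular, it is complete).
   Context: All spaces are complex and operator spaces are complete; $B_X$ is the open unit ball of $X$, and $M_n(V)$ is the space of $n\times n$ matrices over the operator space $V$ with its given norm. A map $f:B_V\to W$ is holomorphic if it is (complex) Fréchet differentiable at every point. A holomorphic function $f:B_V\to W$ is completely bounded holomorphic if $\|f\|_{\mathcal{H}^\infty_{\mathrm{cb}}}=\sup\{\|(f(x_{ij}))\|_{M_m(W)} : m\in\mathbb N,\ (x_{ij})\in B_{M_m(V)}\}<\infty$; the set of all such functions is $\mathcal{H}^\infty_{\mathrm{cb}}(B_V,W)$. *)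

theory Defs
  imports
    "HOL-Analysis.Analysis"
    "HOL-Library.Function_Algebras"
    "Jordan_Normal_Form.Matrix"
begin

unbundle no vec_syntax

(* Euclidean norm of a complex column vector, and the induced operator norm of a (rectangular)
   complex matrix as a map between the Hilbert spaces \<complex>^(dim_col) and \<complex>^(dim_row). *)
definition cvec_norm :: "complex Matrix.vec \<Rightarrow> real" where
  "cvec_norm x = L2_set (\<lambda>i. cmod (x $ i)) {..<dim_vec x}"

definition cmat_norm :: "complex mat \<Rightarrow> real" where
  "cmat_norm A = Sup {cvec_norm (A *\<^sub>v x) | x. x \<in> carrier_vec (dim_col A) \<and> cvec_norm x \<le> 1}"

definition mats :: "nat \<Rightarrow> 'a set \<Rightarrow> 'a mat set" where
  "mats n V = {X \<in> carrier_mat n n. elements_mat X \<subseteq> V}"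

definition dsum_mat :: "'a::zero mat \<Rightarrow> 'a mat \<Rightarrow> 'a mat" where
  "dsum_mat X Y = four_block_mat X (0\<^sub>m (dim_row X) (dim_col Y)) (0\<^sub>m (dim_row Y) (dim_col X)) Y"

(* The product \<alpha> X \<beta> of a matrix X over a complex vector space with scalar matrices. *)
definition bimod_mult ::
  "(complex \<Rightarrow> 'a \<Rightarrow> 'a::comm_monoid_add) \<Rightarrow> complex mat \<Rightarrow> 'a mat \<Rightarrow> complex mat \<Rightarrow> 'a mat" where
  "bimod_mult smul \<alpha> X \<beta> = mat (dim_row \<alpha>) (dim_col \<beta>)
     (\<lambda>(i, j). \<Sum>k<dim_row X. \<Sum>l<dim_col X. smul (\<alpha> $$ (i, k) * \<beta> $$ (l, j)) (X $$ (k, l)))"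

(* Complete (abstract, i.e. Ruan) operator spaces. The underlying space V is a linear subspace of an
   ambient complex vector space, and mnorm restricted to mats n V is the norm of M_n(V), for every
   n > 0; values of mnorm elsewhere are irrelevant. Completeness is that of V = M_1(V), which is
   equivalent to completeness of every M_n(V). *)
locale operator_space = vector_space smul
  for smul :: "complex \<Rightarrow> 'a::ab_group_add \<Rightarrow> 'a" +
  fixes V :: "'a set" and mnorm :: "'a mat \<Rightarrow> real"
  assumes subspace_V: "subspace V"
    and mnorm_nonneg: "\<lbrakk>0 < n; X \<in> mats n V\<rbrakk> \<Longrightarrow> 0 \<le> mnorm X"
    and mnorm_eq_0_iff: "\<lbrakk>0 < n; X \<in> mats n V\<rbrakk> \<Longrightarrow> mnorm X = 0 \<longleftrightarrow> X = 0\<^sub>m n n"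
    and mnorm_triangle: "\<lbrakk>0 < n; X \<in> mats n V; Y \<in> mats n V\<rbrakk> \<Longrightarrow> mnorm (X + Y) \<le> mnorm X + mnorm Y"
    and mnorm_scale: "\<lbrakk>0 < n; X \<in> mats n V\<rbrakk> \<Longrightarrow> mnorm (map_mat (smul c) X) = cmod c * mnorm X"
    and mnorm_dsum: "\<lbrakk>0 < m; 0 < n; X \<in> mats m V; Y \<in> mats n V\<rbrakk> \<Longrightarrow>
      mnorm (dsum_mat X Y) = max (mnorm X) (mnorm Y)"
    and mnorm_bimod: "\<lbrakk>0 < m; 0 < n; \<alpha> \<in> carrier_mat n m; X \<in> mats m V; \<beta> \<in> carrier_mat m n\<rbrakk> \<Longrightarrow>
      mnorm (bimod_mult smul \<alpha> X \<beta>) \<le> cmat_norm \<alpha> * mnorm X * cmat_norm \<beta>"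
    and complete: "\<lbrakk>\<And>k. x k \<in> V;
        \<And>e. e > 0 \<Longrightarrow> \<exists>N. \<forall>k\<ge>N. \<forall>l\<ge>N. mnorm (mat 1 1 (\<lambda>_. x k - x l)) < e\<rbrakk> \<Longrightarrow>
      \<exists>y\<in>V. (\<lambda>k. mnorm (mat 1 1 (\<lambda>_. x k - y))) \<longlonglongrightarrow> 0"

(* An operator space structure on a whole Banach space type: the type class supplies only the
   underlying real Banach space, and its operations are required to be the ones induced by the
   operator space. *)
locale operator_space_type = operator_space smul UNIV mnorm
  for smul :: "complex \<Rightarrow> 'a::banach \<Rightarrow> 'a" and mnorm :: "'a mat \<Rightarrow> real" +
  assumes scaleR_eq: "r *\<^sub>R x = smul (complex_of_real r) x"
    and norm_eq: "norm x = mnorm (mat 1 1 (\<lambda>_. x))"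

definition mat_ball :: "('a mat \<Rightarrow> real) \<Rightarrow> nat \<Rightarrow> 'a mat set" where
  "mat_ball mnorm m = {X \<in> carrier_mat m m. mnorm X < 1}"

(* Complex Frechet differentiability: a real Frechet derivative that is complex linear. *)
definition frechet_holomorphic_on ::
  "(complex \<Rightarrow> 'v \<Rightarrow> 'v) \<Rightarrow> (complex \<Rightarrow> 'w \<Rightarrow> 'w) \<Rightarrow>
   ('v::real_normed_vector \<Rightarrow> 'w::real_normed_vector) \<Rightarrow> 'v set \<Rightarrow> bool" where
  "frechet_holomorphic_on scaleV scaleW f S \<longleftrightarrow>
     (\<forall>x\<in>S. \<exists>D. Vector_Spaces.linear scaleV scaleW D \<and> (f has_derivative D) (at x))"

(* Functions on the open unit ball are represented by total functions vanishing outside it, so that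
   equality and the pointwise operations are those of functions on the ball. *)
definition Hcb ::
  "(complex \<Rightarrow> 'v \<Rightarrow> 'v) \<Rightarrow> ('v mat \<Rightarrow> real) \<Rightarrow> (complex \<Rightarrow> 'w \<Rightarrow> 'w) \<Rightarrow> ('w mat \<Rightarrow> real) \<Rightarrow>
   ('v::real_normed_vector \<Rightarrow> 'w::real_normed_vector) set" where
  "Hcb scaleV mnormV scaleW mnormW =
     {f. (\<forall>x. x \<notin> ball 0 1 \<longrightarrow> f x = 0) \<and>
         frechet_holomorphic_on scaleV scaleW f (ball 0 1) \<and>
         bdd_above {mnormW (map_mat f X) | m X. 0 < m \<and> X \<in> mat_ball mnormV m}}"

definition fun_scale :: "(complex \<Rightarrow> 'w \<Rightarrow> 'w) \<Rightarrow> complex \<Rightarrow> ('v \<Rightarrow> 'w) \<Rightarrow> 'v \<Rightarrow> 'w" where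
  "fun_scale scaleW c f = (\<lambda>x. scaleW c (f x))"

(* For F = (f_kl) and X = (x_ij) of sizes n and m, the nm \<times> nm matrix (f_kl(x_ij)), arranged as an
   n \<times> n array of m \<times> m blocks. *)
definition amplify :: "('v \<Rightarrow> 'w) mat \<Rightarrow> 'v mat \<Rightarrow> 'w mat" where
  "amplify F X = mat (dim_row F * dim_row X) (dim_col F * dim_col X)
     (\<lambda>(p, q). (F $$ (p div dim_row X, q div dim_col X)) (X $$ (p mod dim_row X, q mod dim_col X)))"

definition Hcb_values ::
  "('v mat \<Rightarrow> real) \<Rightarrow> ('w mat \<Rightarrow> real) \<Rightarrow> ('v \<Rightarrow> 'w) mat \<Rightarrow> real set" where
  "Hcb_values mnormV mnormW F = {mnormW (amplify F X) | m X. 0 < m \<and> X \<in> mat_ball mnormV m}"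

definition Hcb_mnorm ::
  "('v mat \<Rightarrow> real) \<Rightarrow> ('w mat \<Rightarrow> real) \<Rightarrow> ('v \<Rightarrow> 'w) mat \<Rightarrow> real" where
  "Hcb_mnorm mnormV mnormW F = Sup (Hcb_values mnormV mnormW F)"

end

(* The norm axioms are inherited pointwise from W, since F \<mapsto> (f_kl(x_ij)) is additive and respects direct
   sums, and turns \<alpha> F \<beta> into (\<alpha> \<otimes> 1_m) (f_kl(x_ij)) (\<beta> \<otimes> 1_m) with norms
   not larger than those of \<alpha> and \<beta>. Splitting F into its entries by matrix units bounds the norm of F
   by the sum of the norms of its entries.

   Completeness needs that a uniform limit of bounded holomorphic maps on the ball is Frechet
   holomorphic. Composing with complex functionals that norm a given vector (Hahn-Banach) reduces a Cauchy
   estimate for Frechet derivatives to the scalar one; the derivatives then converge locally uniformly.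
   Completely bounded norms pass to the limit because each matrix norm is controlled by the norms of
   the entries. *)

theory Submission
  imports Defs "HOL-Complex_Analysis.Cauchy_Integral_Formula"
begin

unbundle no vec_syntax

section \<open>Norming functionals\<close>

text \<open>The delicate point of completeness is that the size m of X is unbounded. The bound of a
  matrix norm by its entries has m^2 terms and is never uniform in m, so it is applied to one fixed
  X at a time, only to carry an inequality over to a pointwise limit. Uniformity in m comes from the
  Cauchy condition itself: it bounds \<open>f k - f l\<close> at all sizes at once, and that bound
  stays the same as l tends to infinity. The analogous bound by the n^2 entries of F, with n fixed,
  makes the suprema finite. The types carry a real Banach structure, with complex scalars acting
  through \<open>smul\<close>. Functionals are therefore found over the reals and complexified by
  hand, at the price of a factor 2 that merely enlarges the constant of the Cauchy estimate.
  Functions vanish off the ball, so pointwise convergence holds at every point and can be applied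
  directly to the entries of X.\<close>

definition sublinear :: "('a::real_vector \<Rightarrow> real) \<Rightarrow> bool" where
  "sublinear p \<longleftrightarrow> (\<forall>x y. p (x + y) \<le> p x + p y) \<and> (\<forall>t\<ge>0. \<forall>x. p (t *\<^sub>R x) = t * p x)"

lemma sublinear_add: "sublinear p \<Longrightarrow> p (x + y) \<le> p x + p y"
  and sublinear_scale: "sublinear p \<Longrightarrow> 0 \<le> t \<Longrightarrow> p (t *\<^sub>R x) = t * p x"
  by (auto simp: sublinear_def)

lemma sublinear_zero: "sublinear p \<Longrightarrow> p 0 = 0"
  using sublinear_scale[of p 0 0] by simp

lemma sublinear_minus_ge: "sublinear p \<Longrightarrow> - p (- x) \<le> p x"
  using sublinear_add[of p x "- x"] sublinear_zero[of p] by simp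

text \<open>Homogeneity follows from one inequality, since applying it to 1/t and
  \<open>t *\<^sub>R x\<close> reverses it. This suits functionals defined as infima, where upper
  bounds are what one can produce.\<close>

lemma sublinearI:
  assumes add: "\<And>x y. p (x + y) \<le> p x + p y"
    and zero: "p 0 = 0"
    and scale: "\<And>t x. 0 < t \<Longrightarrow> p (t *\<^sub>R x) \<le> t * p x"
  shows "sublinear p"
  unfolding sublinear_def
proof (intro conjI allI impI)
  fix t :: real and x assume "0 \<le> t"
  show "p (t *\<^sub>R x) = t * p x"
  proof (cases "t = 0")
    case False
    with \<open>0 \<le> t\<close> have t: "0 < t" by simp
    from scale[of "1 / t" "t *\<^sub>R x"] t have "t * p x \<le> p (t *\<^sub>R x)"
      by (simp add: field_simps)
    with scale[OF t, of x] show ?thesis by simp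
  qed (simp add: zero)
qed (rule add)

text \<open>Used twice below: on a minimal functional it forces oddness, and on the norm it plants
  at - v the value that later makes the functional norming for v.\<close>

lemma sublinear_directional:
  assumes p: "sublinear p"
  obtains q where "sublinear q" "q \<le> p" "q (- y) \<le> - p y"
proof -
  \<comment> \<open>The functional \<open>q\<close> lowers p as far as possible along y. It is
    finite because t * p y is p at the t-fold of y, which is at most p at x plus that multiple, plus
    p (- x). The choice t = 1 at - y gives the value - p y.\<close>
  define g where "g x t = p (x + t *\<^sub>R y) - t * p y" for x t
  define q where "q x = (INF t\<in>{0..}. g x t)" for x
  have lb: "- p (- x) \<le> g x t" if "0 \<le> t" for x t
    using sublinear_add[OF p, of "x + t *\<^sub>R y" "- x"] sublinear_scale[OF p that, of y]
    by (simp add: g_def)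
  have bdd: "bdd_below (g x ` {0..})" for x
    using lb by (auto intro!: bdd_belowI)
  have q_le: "q x \<le> g x t" if "0 \<le> t" for x t
    unfolding q_def using that by (auto intro: cINF_lower bdd)
  have le_q: "c \<le> q x" if "\<And>t. 0 \<le> t \<Longrightarrow> c \<le> g x t" for c x
    unfolding q_def using that by (auto intro!: cINF_greatest)
  have "sublinear q"
  proof (rule sublinearI)
    fix x z
    have *: "q (x + z) \<le> g x s + g z t" if "0 \<le> s" "0 \<le> t" for s t
    proof -
      have "q (x + z) \<le> g (x + z) (s + t)" using that by (intro q_le) auto
      also have "\<dots> \<le> g x s + g z t"
        using sublinear_add[OF p, of "x + s *\<^sub>R y" "z + t *\<^sub>R y"]
        by (simp add: g_def algebra_simps)
      finally show ?thesis .
    qed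
    \<comment> \<open>The two infima are taken one after the other: first over t with s fixed, then
      over s.\<close>
    have "q (x + z) - g x s \<le> q z" if "0 \<le> s" for s
      using * that by (intro le_q) (auto simp: algebra_simps)
    then have "q (x + z) - q z \<le> g x s" if "0 \<le> s" for s
      using that by (simp add: algebra_simps)
    then have "q (x + z) - q z \<le> q x" by (rule le_q)
    then show "q (x + z) \<le> q x + q z" by simp
  next
    have "g 0 t = 0" if "0 \<le> t" for t using sublinear_scale[OF p that] by (simp add: g_def)
    then show "q 0 = 0" unfolding q_def by (subst INF_cong[OF refl, of _ _ "\<lambda>_. 0"]) auto
  next
    fix t :: real and x assume t: "0 < t"
    have "q (t *\<^sub>R x) / t \<le> g x s" if "0 \<le> s" for s
    proof -
      have "q (t *\<^sub>R x) \<le> g (t *\<^sub>R x) (t * s)" using t that by (intro q_le) auto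
      also have "\<dots> = t * g x s"
        using sublinear_scale[OF p, of t "x + s *\<^sub>R y"] t by (simp add: g_def algebra_simps)
      finally show ?thesis using t by (simp add: field_simps)
    qed
    then have "q (t *\<^sub>R x) / t \<le> q x" by (rule le_q)
    then show "q (t *\<^sub>R x) \<le> t * q x" using t by (simp add: field_simps)
  qed
  moreover have "q \<le> p" using q_le[of 0] by (auto simp: le_fun_def g_def)
  moreover have "q (- y) \<le> - p y" using q_le[of 1 "- y"] sublinear_zero[OF p] by (simp add: g_def)
  ultimately show thesis by (rule that)
qed

text \<open>Zorn's lemma for the reversed pointwise order. A chain is bounded below by its pointwise
  infimum, which is finite since every sublinear p below p0 satisfies - p0 (- x) \<le> - p (- x)
  \<le> p x.\<close>

lemma minimal_sublinear:
  assumes p0: "sublinear (p0 :: 'a::real_vector \<Rightarrow> real)"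
  obtains p where "sublinear p" "p \<le> p0" "\<And>q. sublinear q \<Longrightarrow> q \<le> p \<Longrightarrow> q = p"
proof -
  define A where "A = {p. sublinear p \<and> p \<le> p0}"
  have "\<exists>m\<in>A. \<forall>a\<in>A. a \<le> m \<longrightarrow> a = m"
  proof (rule predicate_Zorn)
    show "partial_order_on A (relation_of (\<lambda>p q. q \<le> p) A)"
      by (rule partial_order_on_relation_ofI) auto
  next
    fix C assume C: "C \<in> Chains (relation_of (\<lambda>p q. q \<le> p) A)"
    show "\<exists>u\<in>A. \<forall>a\<in>C. u \<le> a"
    proof (cases "C = {}")
      case True
      then show ?thesis using p0 by (auto simp: A_def)
    next
      case False
      have CA: "C \<subseteq> A" and tot: "\<And>p q. p \<in> C \<Longrightarrow> q \<in> C \<Longrightarrow> p \<le> q \<or> q \<le> p"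
        using C by (auto simp: Chains_def relation_of_def)
      define u where "u x = (INF p\<in>C. p x)" for x
      have "- p0 (- x) \<le> p x" if "p \<in> C" for p x
      proof -
        have "- p (- x) \<le> p x" "p (- x) \<le> p0 (- x)"
          using that CA sublinear_minus_ge by (auto simp: A_def le_fun_def)
        then show ?thesis by simp
      qed
      then have bdd: "bdd_below ((\<lambda>p. p x) ` C)" for x by (auto intro!: bdd_belowI)
      have u_le: "u x \<le> p x" if "p \<in> C" for p x
        unfolding u_def using that bdd by (auto intro: cINF_lower)
      have le_u: "c \<le> u x" if "\<And>p. p \<in> C \<Longrightarrow> c \<le> p x" for c x
        unfolding u_def using that False by (auto intro!: cINF_greatest)
      have sub: "sublinear p" if "p \<in> C" for p using that CA by (auto simp: A_def)
      have "sublinear u"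
      proof (rule sublinearI)
        fix x y
        have *: "u (x + y) \<le> p x + q y" if "p \<in> C" "q \<in> C" for p q
        proof -
          \<comment> \<open>Subadditivity relates values of a single functional, while the two
            infima choose p and q independently. Totality of the chain supplies one r below
            both.\<close>
          obtain r where "r \<in> C" "r \<le> p" "r \<le> q" using tot \<open>p \<in> C\<close> \<open>q \<in> C\<close> by blast
          then show ?thesis
            using u_le[of r "x + y"] sublinear_add[OF sub, of r x y] le_funD[of r p x] le_funD[of r q y]
            by linarith
        qed
        have "u (x + y) - p x \<le> u y" if p: "p \<in> C" for p
        proof (rule le_u)
          fix q assume "q \<in> C"
          from *[OF p this] show "u (x + y) - p x \<le> q y" by simp
        qed
        then have "u (x + y) - u y \<le> p x" if "p \<in> C" for p
          using that by (simp add: algebra_simps)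
        then have "u (x + y) - u y \<le> u x" by (rule le_u)
        then show "u (x + y) \<le> u x + u y" by simp
      next
        have "p 0 = 0" if "p \<in> C" for p using sublinear_zero[OF sub[OF that]] .
        then show "u 0 = 0" unfolding u_def using False
          by (subst INF_cong[OF refl, of _ _ "\<lambda>_. 0"]) auto
      next
        fix t :: real and x assume t: "0 < t"
        have "u (t *\<^sub>R x) / t \<le> p x" if "p \<in> C" for p
          using u_le[OF that, of "t *\<^sub>R x"] sublinear_scale[OF sub[OF that], of t x] t
          by (simp add: field_simps)
        then have "u (t *\<^sub>R x) / t \<le> u x" by (rule le_u)
        then show "u (t *\<^sub>R x) \<le> t * u x" using t by (simp add: field_simps)
      qed
      moreover have "u \<le> p0"
      proof -
        obtain p where "p \<in> C" using False by blast
        then show ?thesis using u_le CA by (force simp: A_def le_fun_def intro: order_trans)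
      qed
      ultimately show ?thesis using u_le by (auto simp: A_def le_fun_def)
    qed
  qed
  then show thesis using that by (auto simp: A_def intro: order_trans)
qed

text \<open>A minimal sublinear functional is odd, hence linear: otherwise \<open>sublinear_directional\<close> would
  produce a smaller one. This gives Hahn-Banach without extending from subspaces.\<close>

lemma norming_functional:
  fixes v :: "'a::real_normed_vector"
  obtains \<phi> where "bounded_linear \<phi>" "\<And>x. \<bar>\<phi> x\<bar> \<le> norm x" "norm v \<le> \<phi> v"
proof -
  have "sublinear (norm :: 'a \<Rightarrow> real)" by (auto simp: sublinear_def norm_triangle_ineq)
  then obtain p0 where p0: "sublinear p0" "p0 \<le> norm" "p0 (- v) \<le> - norm v"
    by (rule sublinear_directional)
  from p0(1) obtain p where p: "sublinear p" "p \<le> p0"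
    and min: "\<And>q. sublinear q \<Longrightarrow> q \<le> p \<Longrightarrow> q = p" by (rule minimal_sublinear) blast
  have neg: "p (- y) = - p y" for y
  proof -
    from p(1) obtain q where "sublinear q" "q \<le> p" "q (- y) \<le> - p y"
      by (rule sublinear_directional)
    with min have "p (- y) \<le> - p y" by blast
    with sublinear_minus_ge[OF p(1), of y] show ?thesis by simp
  qed
  have add: "p (x + y) = p x + p y" for x y
    using sublinear_add[OF p(1), of x y] sublinear_add[OF p(1), of "- x" "- y"]
      neg[of "x + y"] neg[of x] neg[of y] by simp
  have scale: "p (t *\<^sub>R x) = t * p x" for t x
  proof (cases "0 \<le> t")
    case False
    then show ?thesis using sublinear_scale[OF p(1), of "- t" x] neg[of "t *\<^sub>R x"] by simp
  qed (simp add: sublinear_scale[OF p(1)])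
  have le: "p x \<le> norm x" for x using p(2) p0(2) by (force simp: le_fun_def intro: order_trans)
  have bound: "\<bar>p x\<bar> \<le> norm x" for x using le[of x] le[of "- x"] neg[of x] by simp
  show thesis
  proof (rule that)
    show "bounded_linear p" by (rule bounded_linear_intro[where K = 1]) (auto simp: add scale bound)
    \<comment> \<open>Oddness turns the upper bound planted at - v into a lower bound at v.\<close>
    show "norm v \<le> p v" using le_funD[OF p(2), of "- v"] p0(3) neg[of v] by simp
  qed (rule bound)
qed

section \<open>Complex linear norming functionals\<close>

context operator_space_type
begin

lemma mats_UNIV [simp]: "mats n UNIV = carrier_mat n n"
  by (auto simp: mats_def)

lemma norm_smul: "norm (smul c x) = cmod c * norm x"
proof -
  have "map_mat (smul c) (mat 1 1 (\<lambda>_. x)) = mat 1 1 (\<lambda>_. smul c x)" by (rule eq_matI) auto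
  then show ?thesis using mnorm_scale[of 1 "mat 1 1 (\<lambda>_. x)" c] by (simp add: norm_eq)
qed

lemma smul_scaleR: "smul c (r *\<^sub>R x) = r *\<^sub>R smul c x"
  by (simp add: scaleR_eq mult.commute)

lemma bounded_linear_smul: "bounded_linear (smul c)"
  by (rule bounded_linear_intro[where K = "cmod c"])
    (auto simp: scale_right_distrib smul_scaleR norm_smul mult.commute)

lemma bounded_linear_smul_left: "bounded_linear (\<lambda>c. smul c x)"
  by (rule bounded_linear_intro[where K = "norm x"])
    (auto simp: scale_left_distrib scaleR_eq norm_smul scaleR_conv_of_real)

text \<open>The usual complexification: the real part is a real norming functional \<phi>, the
  imaginary part at x is - \<phi> of i x. The factor 2 comes from bounding the modulus by the sum of
  the absolute values of both parts; the real part alone already norms v.\<close>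

lemma complex_norming_functional:
  obtains \<Phi> :: "'a \<Rightarrow> complex" where "bounded_linear \<Phi>" "\<And>c x. \<Phi> (smul c x) = c * \<Phi> x"
    "\<And>x. cmod (\<Phi> x) \<le> 2 * norm x" "norm v \<le> cmod (\<Phi> v)"
proof -
  obtain \<phi> where \<phi>: "bounded_linear \<phi>" "\<And>x. \<bar>\<phi> x\<bar> \<le> norm x" "norm v \<le> \<phi> v"
    using norming_functional[of v] by blast
  interpret \<phi>: bounded_linear \<phi> by (rule \<phi>(1))
  define \<Phi> where "\<Phi> x = Complex (\<phi> x) (- \<phi> (smul \<i> x))" for x
  have bound: "cmod (\<Phi> x) \<le> 2 * norm x" for x
    using cmod_le[of "\<Phi> x"] \<phi>(2)[of x] \<phi>(2)[of "smul \<i> x"] by (simp add: \<Phi>_def norm_smul)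
  have scale: "\<Phi> (smul c x) = c * \<Phi> x" for c x
  proof -
    have 1: "smul c x = Re c *\<^sub>R x + Im c *\<^sub>R smul \<i> x"
      unfolding scaleR_eq scale_scale scale_left_distrib[symmetric]
      by (rule arg_cong[of _ _ "\<lambda>c. smul c x"]) (simp add: complex_eq_iff)
    have 2: "smul \<i> (smul c x) = Re c *\<^sub>R smul \<i> x - Im c *\<^sub>R x"
      unfolding scaleR_eq scale_scale scale_left_diff_distrib[symmetric]
      by (rule arg_cong[of _ _ "\<lambda>c. smul c x"]) (simp add: complex_eq_iff)
    show ?thesis unfolding \<Phi>_def 2 unfolding 1
      by (simp add: complex_eq_iff \<phi>.add \<phi>.diff \<phi>.scale algebra_simps)
  qed
  have "bounded_linear \<Phi>"
  proof (rule bounded_linear_intro[where K = 2])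
    show "\<Phi> (x + y) = \<Phi> x + \<Phi> y" for x y
      by (simp add: \<Phi>_def complex_eq_iff \<phi>.add scale_right_distrib)
    show "\<Phi> (r *\<^sub>R x) = r *\<^sub>R \<Phi> x" for r x
      by (simp add: scaleR_eq scale scaleR_conv_of_real)
  qed (use bound in \<open>simp add: mult.commute\<close>)
  moreover have "norm v \<le> cmod (\<Phi> v)"
    using \<phi>(3) complex_Re_le_cmod[of "\<Phi> v"] by (simp add: \<Phi>_def)
  ultimately show thesis using scale bound by (intro that)
qed

end

section \<open>Cauchy estimates and uniform limits\<close>

locale operator_space_pair =
  V: operator_space_type scaleV mnormV + W: operator_space_type scaleW mnormW
  for scaleV :: "complex \<Rightarrow> 'v::banach \<Rightarrow> 'v" and mnormV :: "'v mat \<Rightarrow> real"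
    and scaleW :: "complex \<Rightarrow> 'w::banach \<Rightarrow> 'w" and mnormW :: "'w mat \<Rightarrow> real"
begin

text \<open>The map is restricted to the complex line through x in direction h and composed with a
  functional norming the vector D x h, which leaves the one-variable Cauchy inequality. In the
  constant 4, one factor 2 is the bound of the functional and the other comes from halving the
  radius. It will be applied to differences of functions.\<close>

lemma cauchy_estimate:
  assumes der: "\<And>y. y \<in> ball x R \<Longrightarrow> (f has_derivative D y) (at y)"
    and lin: "\<And>y. y \<in> ball x R \<Longrightarrow> Vector_Spaces.linear scaleV scaleW (D y)"
    and bound: "\<And>y. y \<in> ball x R \<Longrightarrow> norm (f y) \<le> M" and R: "0 < R"
  shows "norm (D x h) \<le> 4 * M / R * norm h"
proof (cases "h = 0")
  case True
  have "D x 0 = 0" using der[of x] R by (simp add: has_derivative_bounded_linear linear_simps)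
  with True show ?thesis by simp
next
  case False
  obtain \<Phi> :: "'w \<Rightarrow> complex" where \<Phi>: "bounded_linear \<Phi>" "\<And>c w. \<Phi> (scaleW c w) = c * \<Phi> w"
    "\<And>w. cmod (\<Phi> w) \<le> 2 * norm w" "norm (D x h) \<le> cmod (\<Phi> (D x h))"
    using W.complex_norming_functional[of "D x h"] by blast
  \<comment> \<open>Half the parameter radius of the ball, so that the closed disc is mapped into
    the open ball.\<close>
  define \<rho> where "\<rho> = R / (2 * norm h)"
  have \<rho>: "0 < \<rho>" using False R by (simp add: \<rho>_def)
  define g where "g \<zeta> = \<Phi> (f (x + scaleV \<zeta> h))" for \<zeta>
  have in_ball: "x + scaleV \<zeta> h \<in> ball x R" if "cmod \<zeta> \<le> \<rho>" for \<zeta>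
  proof -
    have "cmod \<zeta> * norm h \<le> \<rho> * norm h" using that by (intro mult_right_mono) auto
    also have "\<dots> < R" using False R by (simp add: \<rho>_def)
    finally show ?thesis by (simp add: dist_norm V.norm_smul)
  qed
  have deriv: "(g has_field_derivative \<Phi> (D (x + scaleV \<zeta> h) h)) (at \<zeta>)" if "cmod \<zeta> \<le> \<rho>" for \<zeta>
  proof -
    let ?y = "x + scaleV \<zeta> h"
    have "((\<lambda>\<zeta>. x + scaleV \<zeta> h) has_derivative (\<lambda>\<zeta>. scaleV \<zeta> h)) (at \<zeta>)"
      using bounded_linear_imp_has_derivative[OF V.bounded_linear_smul_left, of h]
      by (auto intro!: derivative_eq_intros)
    from has_derivative_compose[OF this der[OF in_ball[OF that]]]
    have "((\<lambda>\<zeta>. f (x + scaleV \<zeta> h)) has_derivative (\<lambda>z. D ?y (scaleV z h))) (at \<zeta>)" .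
    from bounded_linear.has_derivative[OF \<Phi>(1) this]
    have "(g has_derivative (\<lambda>z. \<Phi> (D ?y (scaleV z h)))) (at \<zeta>)" by (simp add: g_def[abs_def])
    \<comment> \<open>Complex linearity of the derivative turns the real derivative along the line
      into multiplication by one complex number, so g is complex differentiable.\<close>
    moreover have "\<Phi> (D ?y (scaleV z h)) = \<Phi> (D ?y h) * z" for z
    proof -
      interpret Vector_Spaces.linear scaleV scaleW "D ?y" by (rule lin[OF in_ball[OF that]])
      show ?thesis by (simp add: scale \<Phi>(2))
    qed
    ultimately show ?thesis by (simp add: has_field_derivative_def mult.commute[of _ "\<Phi> _"])
  qed
  have "cmod ((deriv ^^ 1) g 0) \<le> fact 1 * (2 * M) / \<rho> ^ 1"
  proof (rule Cauchy_inequality[OF _ _ \<rho>])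
    have diff: "g field_differentiable at \<zeta>" if "cmod \<zeta> \<le> \<rho>" for \<zeta>
      using deriv[OF that] unfolding field_differentiable_def by blast
    show "g holomorphic_on ball 0 \<rho>"
    proof (rule holomorphic_onI)
      fix \<zeta> :: complex assume "\<zeta> \<in> ball 0 \<rho>"
      then have "cmod \<zeta> \<le> \<rho>" by simp
      from diff[OF this] show "g field_differentiable at \<zeta> within ball 0 \<rho>"
        by (rule field_differentiable_at_within)
    qed
    show "continuous_on (cball 0 \<rho>) g"
    proof (rule continuous_at_imp_continuous_on, rule ballI)
      fix \<zeta> :: complex assume "\<zeta> \<in> cball 0 \<rho>"
      then have "cmod \<zeta> \<le> \<rho>" by simp
      from diff[OF this] show "isCont g \<zeta>" by (rule field_differentiable_imp_continuous_at)
    qed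
    fix \<zeta> assume "cmod (0 - \<zeta>) = \<rho>"
    then show "cmod (g \<zeta>) \<le> 2 * M"
      using \<Phi>(3)[of "f (x + scaleV \<zeta> h)"] bound[OF in_ball, of \<zeta>] by (simp add: g_def)
  qed
  moreover have "deriv g 0 = \<Phi> (D x h)"
    using DERIV_imp_deriv[OF deriv[of 0]] \<rho> by simp
  ultimately have "cmod (\<Phi> (D x h)) \<le> 2 * M / \<rho>" by simp
  also have "2 * M / \<rho> = 4 * M / R * norm h" using False R by (simp add: \<rho>_def)
  finally show ?thesis using \<Phi>(4) by simp
qed

text \<open>Near x0 the Cauchy estimate is available with one common radius, so the derivatives are
  uniformly Cauchy relative to norm h. This is the kind of control that
  \<open>has_derivative_sequence\<close> asks for; complex linearity passes to the pointwise limit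
  of the derivatives.\<close>

lemma frechet_holomorphic_on_uniform_limit:
  assumes hol: "\<And>n :: nat. frechet_holomorphic_on scaleV scaleW (f n) (ball 0 1)"
    and unif: "\<And>e. 0 < e \<Longrightarrow> \<exists>N. \<forall>n\<ge>N. \<forall>m\<ge>N. \<forall>x\<in>ball 0 1. norm (f n x - f m x) \<le> e"
    and lim: "\<And>x. x \<in> ball 0 1 \<Longrightarrow> (\<lambda>n. f n x) \<longlonglongrightarrow> g x"
  shows "frechet_holomorphic_on scaleV scaleW g (ball 0 1)"
  unfolding frechet_holomorphic_on_def
proof
  fix x0 :: 'v assume x0: "x0 \<in> ball 0 1"
  obtain D where lin: "\<And>n x. x \<in> ball 0 1 \<Longrightarrow> Vector_Spaces.linear scaleV scaleW (D n x)"
    and der: "\<And>n x. x \<in> ball 0 1 \<Longrightarrow> (f n has_derivative D n x) (at x)"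
    using hol unfolding frechet_holomorphic_on_def by metis
  \<comment> \<open>Half the distance to the unit sphere: a ball of radius R around any point within
    R of x0 remains in the unit ball.\<close>
  define R where "R = (1 - norm x0) / 2"
  have R: "0 < R" using x0 by (simp add: R_def)
  have sub: "ball y R \<subseteq> ball 0 1" if "y \<in> ball x0 R" for y
  proof
    fix z assume "z \<in> ball y R"
    have "norm z \<le> norm (z - y) + norm y" by (metis add.commute norm_triangle_sub)
    moreover have "norm y \<le> norm (y - x0) + norm x0" by (metis add.commute norm_triangle_sub)
    ultimately show "z \<in> ball 0 1" using \<open>z \<in> ball y R\<close> that x0
      by (simp add: R_def dist_norm norm_minus_commute field_simps)
  qed
  have in1: "y \<in> ball 0 1" if "y \<in> ball x0 R" for y using subsetD[OF sub[OF that], of y] R by simp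
  have est: "\<exists>N. \<forall>n\<ge>N. \<forall>m\<ge>N. \<forall>y\<in>ball x0 R. \<forall>h. norm (D n y h - D m y h) \<le> e * norm h"
    if e: "0 < e" for e
  proof -
    obtain N where N: "\<And>n m x. n \<ge> N \<Longrightarrow> m \<ge> N \<Longrightarrow> x \<in> ball 0 1 \<Longrightarrow> norm (f n x - f m x) \<le> e * R / 4"
    proof -
      have "0 < e * R / 4" using e R by simp
      from unif[OF this] show thesis using that by blast
    qed
    have "norm (D n y h - D m y h) \<le> e * norm h"
      if nm: "n \<ge> N" "m \<ge> N" and y: "y \<in> ball x0 R" for n m y h
    proof -
      have "norm (D n y h - D m y h) \<le> 4 * (e * R / 4) / R * norm h"
      proof (rule cauchy_estimate[where D = "\<lambda>y h. D n y h - D m y h"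
            and f = "\<lambda>y. f n y - f m y", OF _ _ _ R])
        fix z assume "z \<in> ball y R"
        then have z: "z \<in> ball 0 1" using sub[OF y] by blast
        show "((\<lambda>y. f n y - f m y) has_derivative (\<lambda>h. D n z h - D m z h)) (at z)"
          by (intro has_derivative_diff der z)
        interpret vector_space_pair scaleV scaleW ..
        show "Vector_Spaces.linear scaleV scaleW (\<lambda>h. D n z h - D m z h)"
          by (rule linear_compose_sub[OF lin lin]; rule z)
        show "norm (f n z - f m z) \<le> e * R / 4" by (rule N[OF nm z])
      qed
      then show ?thesis using R by simp
    qed
    then show ?thesis by blast
  qed
  define D' where "D' y h = lim (\<lambda>n. D n y h)" for y h
  have D': "(\<lambda>n. D n y h) \<longlonglongrightarrow> D' y h" if y: "y \<in> ball x0 R" for y h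
  proof -
    have "Cauchy (\<lambda>n. D n y h)"
    proof (rule CauchyI)
      fix e :: real assume e: "0 < e"
      \<comment> \<open>The summand 1 covers h = 0, and halving e yields a strict
        inequality.\<close>
      define e' where "e' = e / 2 / (norm h + 1)"
      have e': "0 < e'" "e' * norm h < e"
      proof -
        have h: "0 < norm h + 1" using norm_ge_zero[of h] by linarith
        show "0 < e'" using e h by (simp add: e'_def)
        then have "e' * norm h \<le> e' * (norm h + 1)" by (intro mult_left_mono) auto
        also have "\<dots> = e / 2"
          using h nonzero_eq_divide_eq[of "norm h + 1" e' "e / 2"] by (simp only: e'_def) force
        finally show "e' * norm h < e" using e by simp
      qed
      from est[OF e'(1)] obtain N where
        "\<And>n m y h. n \<ge> N \<Longrightarrow> m \<ge> N \<Longrightarrow> y \<in> ball x0 R \<Longrightarrow> norm (D n y h - D m y h) \<le> e' * norm h"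
        by blast
      then show "\<exists>M. \<forall>m\<ge>M. \<forall>n\<ge>M. norm (D m y h - D n y h) < e"
        using y e'(2) by (intro exI[of _ N]) (meson le_less_trans)
    qed
    then show ?thesis by (simp add: D'_def Cauchy_convergent_iff convergent_LIMSEQ_iff)
  qed
  have "\<exists>g'. \<forall>x\<in>ball x0 R. (\<lambda>n. f n x) \<longlonglongrightarrow> g' x \<and> (g' has_derivative D' x) (at x within ball x0 R)"
  proof (rule has_derivative_sequence)
    show "convex (ball x0 R)" by simp
    show "(f n has_derivative D n x) (at x within ball x0 R)" if "x \<in> ball x0 R" for n x
      using der[OF in1[OF that]] by (rule has_derivative_at_withinI)
    show "x0 \<in> ball x0 R" using R by simp
    show "(\<lambda>n. f n x0) \<longlonglongrightarrow> g x0" by (rule lim[OF x0])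
    fix e :: real assume "0 < e"
    from est[OF this] obtain N where
      N: "\<And>n m y h. n \<ge> N \<Longrightarrow> m \<ge> N \<Longrightarrow> y \<in> ball x0 R \<Longrightarrow> norm (D n y h - D m y h) \<le> e * norm h"
      by blast
    \<comment> \<open>Let m tend to infinity in the Cauchy estimate for the derivatives.\<close>
    have "norm (D n y h - D' y h) \<le> e * norm h" if "n \<ge> N" "y \<in> ball x0 R" for n y h
    proof (rule LIMSEQ_le_const2)
      show "(\<lambda>m. norm (D n y h - D m y h)) \<longlonglongrightarrow> norm (D n y h - D' y h)"
        using D'[OF that(2)] by (intro tendsto_intros)
      show "\<exists>M. \<forall>m\<ge>M. norm (D n y h - D m y h) \<le> e * norm h"
        using N[OF that(1) _ that(2)] by blast
    qed
    then show "\<forall>\<^sub>F n in sequentially. \<forall>x\<in>ball x0 R. \<forall>h. norm (D n x h - D' x h) \<le> e * norm h"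
      unfolding eventually_sequentially by blast
  qed
  then obtain g' where g': "\<And>x. x \<in> ball x0 R \<Longrightarrow> (\<lambda>n. f n x) \<longlonglongrightarrow> g' x"
    "\<And>x. x \<in> ball x0 R \<Longrightarrow> (g' has_derivative D' x) (at x within ball x0 R)" by blast
  have x0R: "x0 \<in> ball x0 R" using R by simp
  have "(g' has_derivative D' x0) (at x0)"
    using g'(2)[OF x0R] at_within_open[OF x0R open_ball] by simp
  \<comment> \<open>The theorem on sequences only provides some limit function; uniqueness of limits
    identifies it with g near x0.\<close>
  moreover have "g' x = g x" if "x \<in> ball x0 R" for x
    using LIMSEQ_unique[OF g'(1)[OF that] lim[OF in1[OF that]]] .
  ultimately have "(g has_derivative D' x0) (at x0)"
    using has_derivative_transform_within_open[OF _ open_ball x0R] by blast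
  moreover have "Vector_Spaces.linear scaleV scaleW (D' x0)"
  proof -
    have 1: "Vector_Spaces.linear scaleV scaleW (D n x0)" for n by (rule lin[OF x0])
    have add: "D n x0 (a + b) = D n x0 a + D n x0 b"
      and scale: "D n x0 (scaleV c a) = scaleW c (D n x0 a)" for n a b c
      using 1[of n] by (simp_all add: Vector_Spaces.linear_iff)
    have "D' x0 (a + b) = D' x0 a + D' x0 b" for a b
      using LIMSEQ_unique[OF D'[OF x0R, of "a + b", unfolded add]]
        tendsto_add[OF D'[OF x0R] D'[OF x0R]] by blast
    moreover have "D' x0 (scaleV c a) = scaleW c (D' x0 a)" for c a
      using LIMSEQ_unique[OF D'[OF x0R, of "scaleV c a", unfolded scale]]
        bounded_linear.tendsto[OF W.bounded_linear_smul D'[OF x0R]] by blast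
    ultimately show ?thesis
      using V.vector_space_axioms W.vector_space_axioms by (simp add: Vector_Spaces.linear_iff)
  qed
  ultimately show "\<exists>D. Vector_Spaces.linear scaleV scaleW D \<and> (g has_derivative D) (at x0)" by blast
qed

end

section \<open>Operator norms of ampliated scalar matrices\<close>

lemma cvec_norm_nonneg: "0 \<le> cvec_norm x"
  by (simp add: cvec_norm_def L2_set_nonneg)

lemma cvec_norm_zero [simp]: "cvec_norm (0\<^sub>v n) = 0"
  unfolding cvec_norm_def by (subst L2_set_eq_0_iff) auto

lemma cvec_norm_smult: "cvec_norm (c \<cdot>\<^sub>v x) = cmod c * cvec_norm x"
proof -
  have "cvec_norm (c \<cdot>\<^sub>v x) = L2_set (\<lambda>i. cmod c * cmod (x $ i)) {..<dim_vec x}"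
    unfolding cvec_norm_def by (auto intro!: L2_set_cong simp: norm_mult)
  then show ?thesis by (simp add: cvec_norm_def L2_set_right_distrib)
qed

lemma cvec_norm_squared: "(cvec_norm x)\<^sup>2 = (\<Sum>i<dim_vec x. (cmod (x $ i))\<^sup>2)"
  by (simp add: cvec_norm_def L2_set_def sum_nonneg)

lemma mult_mat_vec_index_sum:
  "\<lbrakk>i < dim_row A; dim_vec x = dim_col A\<rbrakk> \<Longrightarrow> (A *\<^sub>v x) $ i = (\<Sum>j<dim_col A. A $$ (i, j) * x $ j)"
  for A :: "complex mat"
  by (simp add: scalar_prod_def atLeast0LessThan)

text \<open>The crude bound by the sum of the moduli of all entries ensures that the supremum
  defining \<open>cmat_norm\<close> is taken over a bounded set.\<close>

lemma cvec_norm_mult_bounded: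
  fixes A :: "complex mat"
  obtains K where "0 \<le> K" "\<And>x. x \<in> carrier_vec (dim_col A) \<Longrightarrow> cvec_norm (A *\<^sub>v x) \<le> K * cvec_norm x"
proof
  let ?K = "\<Sum>i<dim_row A. \<Sum>j<dim_col A. cmod (A $$ (i, j))"
  show "0 \<le> ?K" by (intro sum_nonneg) auto
  fix x :: "complex Matrix.vec" assume x: "x \<in> carrier_vec (dim_col A)"
  have "cvec_norm (A *\<^sub>v x) \<le> (\<Sum>i<dim_row A. cmod ((A *\<^sub>v x) $ i))"
    unfolding cvec_norm_def by (rule order_trans[OF L2_set_le_sum]) auto
  also have "\<dots> \<le> (\<Sum>i<dim_row A. \<Sum>j<dim_col A. cmod (A $$ (i, j)) * cvec_norm x)"
  proof (rule sum_mono)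
    fix i assume i: "i \<in> {..<dim_row A}"
    have "cmod ((A *\<^sub>v x) $ i) \<le> (\<Sum>j<dim_col A. cmod (A $$ (i, j)) * cmod (x $ j))"
      using i x by (subst mult_mat_vec_index_sum) (auto intro!: sum_norm_le simp: norm_mult)
    also have "\<dots> \<le> (\<Sum>j<dim_col A. cmod (A $$ (i, j)) * cvec_norm x)"
      using x unfolding cvec_norm_def
      by (intro sum_mono mult_left_mono member_le_L2_set[where f = "\<lambda>i. cmod (x $ i)"]) auto
    finally show "cmod ((A *\<^sub>v x) $ i) \<le> (\<Sum>j<dim_col A. cmod (A $$ (i, j)) * cvec_norm x)" .
  qed
  also have "\<dots> = ?K * cvec_norm x" by (simp add: sum_distrib_right)
  finally show "cvec_norm (A *\<^sub>v x) \<le> ?K * cvec_norm x" .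
qed

lemma cmat_norm_bdd_above:
  "bdd_above {cvec_norm (A *\<^sub>v x) | x. x \<in> carrier_vec (dim_col A) \<and> cvec_norm x \<le> 1}"
proof -
  obtain K where "0 \<le> K" "\<And>x. x \<in> carrier_vec (dim_col A) \<Longrightarrow> cvec_norm (A *\<^sub>v x) \<le> K * cvec_norm x"
    using cvec_norm_mult_bounded by blast
  then show ?thesis by (intro bdd_aboveI[of _ K]) (force intro: order_trans mult_left_le)
qed

lemma cmat_norm_upper:
  "\<lbrakk>x \<in> carrier_vec (dim_col A); cvec_norm x \<le> 1\<rbrakk> \<Longrightarrow> cvec_norm (A *\<^sub>v x) \<le> cmat_norm A"
  unfolding cmat_norm_def by (rule cSup_upper[OF _ cmat_norm_bdd_above]) blast

lemma cmat_norm_nonneg: "0 \<le> cmat_norm A"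
  using cmat_norm_upper[of "0\<^sub>v (dim_col A)" A] cvec_norm_nonneg[of "A *\<^sub>v 0\<^sub>v (dim_col A)"] by simp

lemma cmat_norm_least:
  assumes "0 \<le> K" and "\<And>x. x \<in> carrier_vec (dim_col A) \<Longrightarrow> cvec_norm (A *\<^sub>v x) \<le> K * cvec_norm x"
  shows "cmat_norm A \<le> K"
  unfolding cmat_norm_def
proof (rule cSup_least)
  have "0\<^sub>v (dim_col A) \<in> carrier_vec (dim_col A) \<and> cvec_norm (0\<^sub>v (dim_col A)) \<le> 1" by simp
  then show "{cvec_norm (A *\<^sub>v x) | x. x \<in> carrier_vec (dim_col A) \<and> cvec_norm x \<le> 1} \<noteq> {}" by blast
qed (use assms in \<open>force intro: order_trans mult_left_le\<close>)

lemma cvec_norm_mult_le: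
  assumes x: "x \<in> carrier_vec (dim_col A)"
  shows "cvec_norm (A *\<^sub>v x) \<le> cmat_norm A * cvec_norm x"
proof (cases "cvec_norm x = 0")
  case True
  \<comment> \<open>A vector of norm 0 cannot be normalised; the crude bound gives the claim
    directly.\<close>
  then show ?thesis using cvec_norm_mult_bounded[of A] x by (metis mult_zero_right)
next
  case False
  then have pos: "0 < cvec_norm x" using cvec_norm_nonneg[of x] by simp
  let ?c = "complex_of_real (1 / cvec_norm x)"
  have "cvec_norm (A *\<^sub>v (?c \<cdot>\<^sub>v x)) \<le> cmat_norm A"
    using x pos by (intro cmat_norm_upper) (auto simp: cvec_norm_smult norm_divide)
  moreover have "A *\<^sub>v (?c \<cdot>\<^sub>v x) = ?c \<cdot>\<^sub>v (A *\<^sub>v x)"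
    by (rule mult_mat_vec[of A "dim_row A" "dim_col A"]) (use x in auto)
  ultimately show ?thesis using pos by (simp add: cvec_norm_smult norm_divide field_simps)
qed

text \<open>The Kronecker product \<alpha> \<otimes> 1_m in the block order of
  \<open>amplify\<close>: p div m is the index into \<alpha>, p mod m the position inside a
  block.\<close>

definition kron_one :: "complex mat \<Rightarrow> nat \<Rightarrow> complex mat" where
  "kron_one \<alpha> m = mat (dim_row \<alpha> * m) (dim_col \<alpha> * m)
     (\<lambda>(p, q). if p mod m = q mod m then \<alpha> $$ (p div m, q div m) else 0)"

lemma kron_one_carrier [simp]:
  "\<alpha> \<in> carrier_mat n r \<Longrightarrow> kron_one \<alpha> m \<in> carrier_mat (n * m) (r * m)"
  by (auto simp: kron_one_def)

lemma block_index_less: "\<lbrakk>j < m; k < n\<rbrakk> \<Longrightarrow> j + k * m < n * (m::nat)"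
proof -
  assume "j < m" "k < n"
  then have "j + k * m < Suc k * m" by simp
  also have "\<dots> \<le> n * m" by (rule mult_le_mono1) (use \<open>k < n\<close> in simp)
  finally show ?thesis .
qed

lemma kron_one_index_row:
  assumes "p < dim_row \<alpha> * m" "j < m" "k < dim_col \<alpha>"
  shows "kron_one \<alpha> m $$ (p, j + k * m) = (if j = p mod m then \<alpha> $$ (p div m, k) else 0)"
  using assms block_index_less[of j m k] by (auto simp: kron_one_def)

lemma kron_one_index_col:
  assumes "p < dim_col \<alpha> * m" "j < m" "k < dim_row \<alpha>"
  shows "kron_one \<alpha> m $$ (j + k * m, p) = (if j = p mod m then \<alpha> $$ (k, p div m) else 0)"
  using assms block_index_less[of j m k] by (auto simp: kron_one_def)

text \<open>Up to a permutation of coordinates, the ampliation acts as \<open>m\<close> independent copies of \<open>\<alpha>\<close>.\<close>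

lemma cmat_norm_kron_one: "cmat_norm (kron_one \<alpha> m) \<le> cmat_norm \<alpha>"
proof (rule cmat_norm_least[OF cmat_norm_nonneg])
  fix x :: "complex Matrix.vec" assume "x \<in> carrier_vec (dim_col (kron_one \<alpha> m))"
  then have dim: "dim_vec x = dim_col \<alpha> * m" by (simp add: kron_one_def)
  define xs where "xs j = vec (dim_col \<alpha>) (\<lambda>k. x $ (j + k * m))" for j
  have entry: "(kron_one \<alpha> m *\<^sub>v x) $ (j + k * m) = (\<alpha> *\<^sub>v xs j) $ k"
    if j: "j < m" and k: "k < dim_row \<alpha>" for j k
  proof -
    have p: "j + k * m < dim_row \<alpha> * m" using j k by (rule block_index_less)
    have "(kron_one \<alpha> m *\<^sub>v x) $ (j + k * m) =
        (\<Sum>q<dim_col \<alpha> * m. kron_one \<alpha> m $$ (j + k * m, q) * x $ q)"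
      using p dim by (subst mult_mat_vec_index_sum) (auto simp: kron_one_def)
    also have "\<dots> = (\<Sum>l<dim_col \<alpha>. \<Sum>i<m. if i = j then \<alpha> $$ (k, l) * x $ (i + l * m) else 0)"
      unfolding sum_mult_product
      using p j by (intro sum.cong refl) (auto simp: kron_one_index_row)
    also have "\<dots> = (\<alpha> *\<^sub>v xs j) $ k"
      using j k by (subst mult_mat_vec_index_sum) (auto simp: xs_def)
    finally show ?thesis .
  qed
  have "(cvec_norm (kron_one \<alpha> m *\<^sub>v x))\<^sup>2 = (\<Sum>k<dim_row \<alpha>. \<Sum>j<m. (cmod ((\<alpha> *\<^sub>v xs j) $ k))\<^sup>2)"
  proof -
    have "dim_vec (kron_one \<alpha> m *\<^sub>v x) = dim_row \<alpha> * m" by (simp add: kron_one_def)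
    then show ?thesis unfolding cvec_norm_squared
      by (simp only: sum_mult_product) (intro sum.cong refl, simp add: entry del: index_mult_mat_vec)
  qed
  also have "\<dots> = (\<Sum>j<m. (cvec_norm (\<alpha> *\<^sub>v xs j))\<^sup>2)"
    unfolding cvec_norm_squared by (subst sum.swap) simp
  also have "\<dots> \<le> (\<Sum>j<m. (cmat_norm \<alpha> * cvec_norm (xs j))\<^sup>2)"
    by (intro sum_mono power_mono cvec_norm_mult_le cvec_norm_nonneg) (simp add: xs_def)
  also have "\<dots> = (cmat_norm \<alpha>)\<^sup>2 * (\<Sum>j<m. \<Sum>k<dim_col \<alpha>. (cmod (x $ (j + k * m)))\<^sup>2)"
    by (simp add: power_mult_distrib sum_distrib_left cvec_norm_squared xs_def)
  also have "\<dots> = (cmat_norm \<alpha> * cvec_norm x)\<^sup>2"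
    by (subst sum.swap) (simp add: power_mult_distrib cvec_norm_squared dim sum_mult_product)
  finally show "cvec_norm (kron_one \<alpha> m *\<^sub>v x) \<le> cmat_norm \<alpha> * cvec_norm x"
    by (rule power2_le_imp_le) (simp add: cmat_norm_nonneg cvec_norm_nonneg)
qed

lemma sum_apply: "(\<Sum>i\<in>A. f i) x = (\<Sum>i\<in>A. f i x)"
  by (induction A rule: infinite_finite_induct) auto

text \<open>Splitting each summation index into block and position, the identity factors leave only
  the positions p mod m and q mod m. What remains is the bimodule product over the blocks, evaluated
  at that single entry of X.\<close>

lemma bimod_mult_kron_one:
  fixes F :: "('v \<Rightarrow> 'w::comm_monoid_add) mat"
  assumes smul_0: "\<And>w. smul 0 w = 0"
    and F: "F \<in> carrier_mat r s" and \<alpha>: "\<alpha> \<in> carrier_mat n r" and \<beta>: "\<beta> \<in> carrier_mat s n'"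
    and X: "X \<in> carrier_mat m m"
  shows "bimod_mult smul (kron_one \<alpha> m) (amplify F X) (kron_one \<beta> m) =
    amplify (bimod_mult (fun_scale smul) \<alpha> F \<beta>) X"
proof (rule eq_matI)
  show "dim_row (bimod_mult smul (kron_one \<alpha> m) (amplify F X) (kron_one \<beta> m)) =
      dim_row (amplify (bimod_mult (fun_scale smul) \<alpha> F \<beta>) X)"
    "dim_col (bimod_mult smul (kron_one \<alpha> m) (amplify F X) (kron_one \<beta> m)) =
      dim_col (amplify (bimod_mult (fun_scale smul) \<alpha> F \<beta>) X)"
    using assms by (auto simp: bimod_mult_def kron_one_def amplify_def)
next
  fix p q
  assume "p < dim_row (amplify (bimod_mult (fun_scale smul) \<alpha> F \<beta>) X)"
    and "q < dim_col (amplify (bimod_mult (fun_scale smul) \<alpha> F \<beta>) X)"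
  then have p: "p < n * m" and q: "q < n' * m" using assms by (auto simp: bimod_mult_def amplify_def)
  have m: "0 < m" using p by (cases m) auto
  have pq: "p div m < n" "q div m < n'" "p mod m < m" "q mod m < m"
    using p q m by (auto simp: less_mult_imp_div_less)
  have amp: "amplify F X $$ (i + k * m, j + l * m) = (F $$ (k, l)) (X $$ (i, j))"
    if "i < m" "j < m" "k < r" "l < s" for i j k l
    using that F X block_index_less[of i m k r] block_index_less[of j m l s]
    by (auto simp: amplify_def)
  have "bimod_mult smul (kron_one \<alpha> m) (amplify F X) (kron_one \<beta> m) $$ (p, q) =
      (\<Sum>k<r * m. \<Sum>l<s * m. smul (kron_one \<alpha> m $$ (p, k) * kron_one \<beta> m $$ (l, q)) (amplify F X $$ (k, l)))"
    using p q assms by (auto simp: bimod_mult_def kron_one_def amplify_def)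
  also have "\<dots> = (\<Sum>k<r. \<Sum>i<m. \<Sum>l<s. \<Sum>j<m. if j = q mod m then if i = p mod m then
      smul (\<alpha> $$ (p div m, k) * \<beta> $$ (l, q div m)) ((F $$ (k, l)) (X $$ (i, j))) else 0 else 0)"
    unfolding sum_mult_product using p q \<alpha> \<beta>
    by (intro sum.cong refl) (auto simp: kron_one_index_row kron_one_index_col amp smul_0)
  also have "\<dots> = (\<Sum>k<r. \<Sum>i<m. if i = p mod m then (\<Sum>l<s.
      smul (\<alpha> $$ (p div m, k) * \<beta> $$ (l, q div m)) ((F $$ (k, l)) (X $$ (i, q mod m)))) else 0)"
    using pq by (intro sum.cong refl) auto
  also have "\<dots> = (\<Sum>k<r. \<Sum>l<s.
      smul (\<alpha> $$ (p div m, k) * \<beta> $$ (l, q div m)) ((F $$ (k, l)) (X $$ (p mod m, q mod m))))"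
    using pq by simp
  also have "\<dots> = amplify (bimod_mult (fun_scale smul) \<alpha> F \<beta>) X $$ (p, q)"
    using p q pq assms by (simp add: amplify_def bimod_mult_def sum_apply fun_scale_def)
  finally show "bimod_mult smul (kron_one \<alpha> m) (amplify F X) (kron_one \<beta> m) $$ (p, q) =
    amplify (bimod_mult (fun_scale smul) \<alpha> F \<beta>) X $$ (p, q)" .
qed

section \<open>Amplification of matrices of functions\<close>

lemma amplify_carrier [simp]:
  "\<lbrakk>F \<in> carrier_mat n n'; X \<in> carrier_mat m m'\<rbrakk> \<Longrightarrow> amplify F X \<in> carrier_mat (n * m) (n' * m')"
  by (auto simp: amplify_def)

lemma amplify_index:
  assumes "F \<in> carrier_mat n n'" "X \<in> carrier_mat m m'" "p < n * m" "q < n' * m'"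
  shows "amplify F X $$ (p, q) = (F $$ (p div m, q div m')) (X $$ (p mod m, q mod m'))"
  using assms by (auto simp: amplify_def)

lemma div_mod_less:
  fixes p n m :: nat
  assumes "p < n * m"
  shows "p div m < n" "p mod m < m"
proof -
  show "p div m < n" by (rule less_mult_imp_div_less[OF assms])
  show "p mod m < m" using assms by (cases m) auto
qed

lemma amplify_add:
  assumes F: "F \<in> carrier_mat n n'" and G: "G \<in> carrier_mat n n'" and X: "X \<in> carrier_mat m m'"
  shows "amplify (F + G) X = amplify F X + amplify G X"
proof (rule eq_matI)
  fix p q assume "p < dim_row (amplify F X + amplify G X)" "q < dim_col (amplify F X + amplify G X)"
  then have p: "p < n * m" and q: "q < n' * m'" using amplify_carrier[OF G X] by auto
  have FG: "F + G \<in> carrier_mat n n'" using F G by simp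
  show "amplify (F + G) X $$ (p, q) = (amplify F X + amplify G X) $$ (p, q)"
    using p q F G div_mod_less[OF p] div_mod_less[OF q] amplify_carrier[OF G X]
    by (simp add: amplify_index[OF FG X] amplify_index[OF F X] amplify_index[OF G X])
qed (use assms in \<open>auto simp: amplify_def\<close>)

lemma amplify_map:
  assumes F: "F \<in> carrier_mat n n'" and X: "X \<in> carrier_mat m m'"
  shows "amplify (map_mat (fun_scale s c) F) X = map_mat (s c) (amplify F X)"
proof (rule eq_matI)
  fix p q
  assume "p < dim_row (map_mat (s c) (amplify F X))" "q < dim_col (map_mat (s c) (amplify F X))"
  then have p: "p < n * m" and q: "q < n' * m'" using amplify_carrier[OF F X] by auto
  have cF: "map_mat (fun_scale s c) F \<in> carrier_mat n n'" using F by simp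
  show "amplify (map_mat (fun_scale s c) F) X $$ (p, q) = map_mat (s c) (amplify F X) $$ (p, q)"
    using p q F div_mod_less[OF p] div_mod_less[OF q] amplify_carrier[OF F X]
    by (simp add: amplify_index[OF cF X] amplify_index[OF F X] fun_scale_def)
qed (use assms in \<open>auto simp: amplify_def\<close>)

lemma dsum_carrier:
  "\<lbrakk>X \<in> carrier_mat m m; Y \<in> carrier_mat n n\<rbrakk> \<Longrightarrow> dsum_mat X Y \<in> carrier_mat (m + n) (m + n)"
  by (auto simp: dsum_mat_def)

lemma dsum_index:
  assumes "X \<in> carrier_mat m m" "Y \<in> carrier_mat n n" "i < m + n" "j < m + n"
  shows "dsum_mat X Y $$ (i, j) = (if i < m \<and> j < m then X $$ (i, j)
    else if m \<le> i \<and> m \<le> j then Y $$ (i - m, j - m) else 0)"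
  using assms by (auto simp: dsum_mat_def)

text \<open>The function index is the outer one in \<open>amplify\<close>, so the rows of F precede
  those of G as whole blocks and the identity is literal, with no permutation of indices.\<close>

lemma amplify_dsum:
  fixes F :: "('v \<Rightarrow> 'w::zero) mat"
  assumes F: "F \<in> carrier_mat n n" and G: "G \<in> carrier_mat n' n'" and X: "X \<in> carrier_mat m m"
  shows "amplify (dsum_mat F G) X = dsum_mat (amplify F X) (amplify G X)"
proof (rule eq_matI)
  have D: "dsum_mat (amplify F X) (amplify G X) \<in> carrier_mat (n * m + n' * m) (n * m + n' * m)"
    using assms by (intro dsum_carrier amplify_carrier)
  have A: "amplify (dsum_mat F G) X \<in> carrier_mat ((n + n') * m) ((n + n') * m)"
    using assms by (intro dsum_carrier amplify_carrier)
  show "dim_row (amplify (dsum_mat F G) X) = dim_row (dsum_mat (amplify F X) (amplify G X))"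
    "dim_col (amplify (dsum_mat F G) X) = dim_col (dsum_mat (amplify F X) (amplify G X))"
    using A D by (auto simp: algebra_simps)
  fix p q assume "p < dim_row (dsum_mat (amplify F X) (amplify G X))"
    "q < dim_col (dsum_mat (amplify F X) (amplify G X))"
  then have p: "p < n * m + n' * m" and q: "q < n * m + n' * m" using D by auto
  then have p': "p < (n + n') * m" and q': "q < (n + n') * m" by (auto simp: algebra_simps)
  have m: "0 < m" using p by (cases m) auto
  \<comment> \<open>The block index p div m decides which summand row p belongs to; subtracting n *
    m lowers that index by n and keeps the position inside the block.\<close>
  have small: "r div m < n \<longleftrightarrow> r < n * m" for r using m by (simp add: div_less_iff_less_mult)
  have shift: "(r - n * m) div m = r div m - n" "(r - n * m) mod m = r mod m" if "n * m \<le> r" for r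
  proof -
    from that obtain s where "r = s + n * m" by (metis add.commute le_Suc_ex)
    then show "(r - n * m) div m = r div m - n" "(r - n * m) mod m = r mod m" using m by auto
  qed
  have shift_less: "r - n * m < n' * m" if "r < n * m + n' * m" "n * m \<le> r" for r
    using that by linarith
  show "amplify (dsum_mat F G) X $$ (p, q) = dsum_mat (amplify F X) (amplify G X) $$ (p, q)"
    using p q div_mod_less[OF p'] div_mod_less[OF q'] small[of p] small[of q] shift[of p] shift[of q]
      shift_less[of p] shift_less[of q]
    by (auto simp: amplify_index[OF dsum_carrier[OF F G] X p' q'] dsum_index[OF F G]
        dsum_index[OF amplify_carrier[OF F X] amplify_carrier[OF G X] p q]
        amplify_index[OF F X] amplify_index[OF G X] not_less simp flip: not_less)
qed

lemma amplify_one_by_one: "X \<in> carrier_mat m m' \<Longrightarrow> amplify (mat 1 1 (\<lambda>_. f)) X = map_mat f X"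
  by (rule eq_matI) (auto simp: amplify_def)

section \<open>Matrix units and entrywise bounds\<close>

definition unit_col :: "nat \<Rightarrow> nat \<Rightarrow> complex mat" where
  "unit_col n k = mat n 1 (\<lambda>(i, _). if i = k then 1 else 0)"

text \<open>For k, l < n, multiplying a 1 x 1 matrix by \<open>unit_col n k\<close> on the left and
  \<open>unit_row n l\<close> on the right puts its entry at position (k, l) of an otherwise zero n
  x n matrix.\<close>

definition unit_row :: "nat \<Rightarrow> nat \<Rightarrow> complex mat" where
  "unit_row n k = mat 1 n (\<lambda>(_, j). if j = k then 1 else 0)"

lemma unit_carrier [simp]: "unit_col n k \<in> carrier_mat n 1" "unit_row n k \<in> carrier_mat 1 n"
  by (auto simp: unit_col_def unit_row_def)

lemma unit_dim [simp]:
  "dim_row (unit_col n k) = n" "dim_col (unit_col n k) = 1"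
  "dim_row (unit_row n k) = 1" "dim_col (unit_row n k) = n"
  by (auto simp: unit_col_def unit_row_def)

lemma cmat_norm_unit_col: "cmat_norm (unit_col n k) \<le> 1"
proof (rule cmat_norm_least)
  fix x :: "complex Matrix.vec" assume "x \<in> carrier_vec (dim_col (unit_col n k))"
  then have x: "dim_vec x = 1" by (simp add: unit_col_def)
  have "(cvec_norm (unit_col n k *\<^sub>v x))\<^sup>2 = (\<Sum>i<n. if i = k then (cmod (x $ 0))\<^sup>2 else 0)"
    unfolding cvec_norm_squared dim_mult_mat_vec unit_dim using x
    by (intro sum.cong refl)
      (auto simp: unit_col_def mult_mat_vec_index_sum simp del: index_mult_mat_vec)
  also have "\<dots> \<le> (cvec_norm x)\<^sup>2" using x by (simp add: cvec_norm_squared)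
  finally show "cvec_norm (unit_col n k *\<^sub>v x) \<le> 1 * cvec_norm x"
    using power2_le_imp_le[OF _ cvec_norm_nonneg] by simp
qed simp

lemma cmat_norm_unit_row: "cmat_norm (unit_row n k) \<le> 1"
proof (rule cmat_norm_least)
  fix x :: "complex Matrix.vec" assume "x \<in> carrier_vec (dim_col (unit_row n k))"
  then have x: "dim_vec x = n" by (simp add: unit_row_def)
  have "(unit_row n k *\<^sub>v x) $ 0 = (\<Sum>j<n. if j = k then x $ j else 0)"
  proof -
    have "(unit_row n k *\<^sub>v x) $ 0 = (\<Sum>j<n. unit_row n k $$ (0, j) * x $ j)"
      using x by (subst mult_mat_vec_index_sum) auto
    also have "\<dots> = (\<Sum>j<n. if j = k then x $ j else 0)"
      by (intro sum.cong refl) (auto simp: unit_row_def)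
    finally show ?thesis .
  qed
  then have "(cvec_norm (unit_row n k *\<^sub>v x))\<^sup>2 = (if k < n then (cmod (x $ k))\<^sup>2 else 0)"
    unfolding cvec_norm_squared by (simp del: index_mult_mat_vec)
  also have "\<dots> \<le> (cvec_norm x)\<^sup>2"
    using x member_le_sum[of k "{..<n}" "\<lambda>i. (cmod (x $ i))\<^sup>2"]
    by (auto simp: cvec_norm_squared sum_nonneg)
  finally show "cvec_norm (unit_row n k *\<^sub>v x) \<le> 1 * cvec_norm x"
    using power2_le_imp_le[OF _ cvec_norm_nonneg] by simp
qed simp

lemma vector_space_fun_scale:
  assumes "vector_space s"
  shows "vector_space (fun_scale s)"
proof -
  interpret vector_space s by (rule assms)
  show ?thesis
    by unfold_locales (auto simp: fun_scale_def fun_eq_iff scale_right_distrib scale_left_distrib)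
qed

context operator_space_type
begin

lemma mnorm_amplify_bimod:
  fixes F :: "('v \<Rightarrow> 'a) mat"
  assumes pos: "0 < n" "0 < r" "0 < m" and F: "F \<in> carrier_mat r r"
    and \<alpha>: "\<alpha> \<in> carrier_mat n r" and \<beta>: "\<beta> \<in> carrier_mat r n" and X: "X \<in> carrier_mat m m"
  shows "mnorm (amplify (bimod_mult (fun_scale smul) \<alpha> F \<beta>) X)
    \<le> cmat_norm \<alpha> * mnorm (amplify F X) * cmat_norm \<beta>"
proof -
  have A: "amplify F X \<in> carrier_mat (r * m) (r * m)" using F X by simp
  have "mnorm (amplify (bimod_mult (fun_scale smul) \<alpha> F \<beta>) X) =
      mnorm (bimod_mult smul (kron_one \<alpha> m) (amplify F X) (kron_one \<beta> m))"
    using bimod_mult_kron_one[where smul = smul, OF scale_zero_left F \<alpha> \<beta> X] by simp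
  also have "\<dots> \<le> cmat_norm (kron_one \<alpha> m) * mnorm (amplify F X) * cmat_norm (kron_one \<beta> m)"
    using pos A \<alpha> \<beta> by (intro mnorm_bimod[of "r * m" "n * m"]) auto
  also have "\<dots> \<le> cmat_norm \<alpha> * mnorm (amplify F X) * cmat_norm \<beta>"
    using pos A by (intro mult_mono cmat_norm_kron_one cmat_norm_nonneg mult_nonneg_nonneg
        mult_right_mono mnorm_nonneg[of "r * m"]) auto
  finally show ?thesis .
qed

text \<open>F is filled in one entry at a time. Each new entry is added as a bimodule product of a 1
  x 1 matrix with unit vectors of operator norm at most 1, hence costs no more than its own
  norm.\<close>

lemma mnorm_amplify_le_sum:
  fixes F :: "('v \<Rightarrow> 'a) mat"
  assumes F: "F \<in> carrier_mat n n" and X: "X \<in> carrier_mat m m" and pos: "0 < n" "0 < m"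
  shows "mnorm (amplify F X) \<le> (\<Sum>k<n. \<Sum>l<n. mnorm (map_mat (F $$ (k, l)) X))"
proof -
  \<comment> \<open>\<open>P S\<close> keeps the entries of F at the positions in S and is 0
    elsewhere; the induction runs over S.\<close>
  define P where "P S = mat n n (\<lambda>kl. if kl \<in> S then F $$ kl else 0)" for S
  have P: "P S \<in> carrier_mat n n" for S by (simp add: P_def)
  have "mnorm (amplify (P S) X) \<le> (\<Sum>kl\<in>S. mnorm (map_mat (F $$ kl) X))"
    if "finite S" "S \<subseteq> {..<n} \<times> {..<n}" for S
    using that
  proof (induction S rule: finite_induct)
    case empty
    have "amplify (P {}) X = 0\<^sub>m (n * m) (n * m)"
      using X by (intro eq_matI) (auto simp: P_def amplify_def div_mod_less)
    then show ?case using mnorm_eq_0_iff[of "n * m" "0\<^sub>m (n * m) (n * m)"] pos by simp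
  next
    case (insert s S)
    obtain k l where s: "s = (k, l)" "k < n" "l < n" using insert.prems by auto
    let ?E = "bimod_mult (fun_scale smul) (unit_col n k) (mat 1 1 (\<lambda>_. F $$ s)) (unit_row n l)"
    have E: "?E \<in> carrier_mat n n" by (simp add: bimod_mult_def unit_col_def unit_row_def)
    have "P (insert s S) = P S + ?E"
      using insert.hyps s
      by (intro eq_matI) (auto simp: P_def bimod_mult_def unit_col_def unit_row_def fun_scale_def
          fun_eq_iff)
    then have "amplify (P (insert s S)) X = amplify (P S) X + amplify ?E X"
      using amplify_add[OF P E X] by simp
    then have "mnorm (amplify (P (insert s S)) X) \<le> mnorm (amplify (P S) X) + mnorm (amplify ?E X)"
      using mnorm_triangle[of "n * m" "amplify (P S) X" "amplify ?E X"] pos P E X by simp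
    also have "mnorm (amplify (P S) X) \<le> (\<Sum>kl\<in>S. mnorm (map_mat (F $$ kl) X))"
      using insert by simp
    also have "mnorm (amplify ?E X) \<le> mnorm (map_mat (F $$ s) X)"
    proof -
      have nn: "0 \<le> mnorm (map_mat (F $$ s) X)" using pos X by (intro mnorm_nonneg[of m]) auto
      have "mnorm (amplify ?E X) \<le>
          cmat_norm (unit_col n k) * mnorm (amplify (mat 1 1 (\<lambda>_. F $$ s)) X) * cmat_norm (unit_row n l)"
        using pos X by (intro mnorm_amplify_bimod[where r = 1]) auto
      also have "\<dots> \<le> 1 * mnorm (amplify (mat 1 1 (\<lambda>_. F $$ s)) X) * 1"
        unfolding amplify_one_by_one[OF X] using nn
        by (intro mult_mono cmat_norm_unit_col cmat_norm_unit_row mult_nonneg_nonneg cmat_norm_nonneg) auto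
      finally show ?thesis unfolding amplify_one_by_one[OF X] by simp
    qed
    finally show ?case using insert.hyps by simp
  qed
  from this[of "{..<n} \<times> {..<n}"] have
    "mnorm (amplify (P ({..<n} \<times> {..<n})) X) \<le> (\<Sum>k<n. \<Sum>l<n. mnorm (map_mat (F $$ (k, l)) X))"
    by (simp add: sum.cartesian_product)
  moreover have "P ({..<n} \<times> {..<n}) = F" using F by (intro eq_matI) (auto simp: P_def)
  ultimately show ?thesis by simp
qed

text \<open>A matrix of vectors is a matrix of functions on a one-point type, amplified at the 1 x 1
  matrix of that point. The bound for matrices of functions thus specialises to vectors.\<close>

lemma mnorm_le_sum_norm:
  assumes Y: "Y \<in> carrier_mat m m" and m: "0 < m"
  shows "mnorm Y \<le> (\<Sum>i<m. \<Sum>j<m. norm (Y $$ (i, j)))"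
proof -
  let ?F = "map_mat (\<lambda>w (_ :: unit). w) Y" and ?X = "mat 1 1 (\<lambda>_. ())"
  have "amplify ?F ?X = Y" using Y by (intro eq_matI) (auto simp: amplify_def)
  moreover have "map_mat (?F $$ (i, j)) ?X = mat 1 1 (\<lambda>_. Y $$ (i, j))" if "i < m" "j < m" for i j
    using that Y by (intro eq_matI) auto
  ultimately show ?thesis
    using mnorm_amplify_le_sum[of ?F m ?X 1] Y m by (simp add: norm_eq)
qed

end

section \<open>The operator space of completely bounded holomorphic functions\<close>

lemma zero_less_one_nat: "0 < (1 :: nat)"
  by simp

lemma mats_carrier: "F \<in> mats n S \<Longrightarrow> F \<in> carrier_mat n n"
  by (simp add: mats_def)

lemma mats_index: "\<lbrakk>F \<in> mats n S; k < n; l < n\<rbrakk> \<Longrightarrow> F $$ (k, l) \<in> S"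
  by (auto simp: mats_def)

lemma matsI:
  "\<lbrakk>F \<in> carrier_mat n n; \<And>k l. \<lbrakk>k < n; l < n\<rbrakk> \<Longrightarrow> F $$ (k, l) \<in> S\<rbrakk> \<Longrightarrow> F \<in> mats n S"
  by (auto simp: mats_def elements_mat_def)

context operator_space_pair
begin

abbreviation "H \<equiv> Hcb scaleV mnormV scaleW mnormW"

lemma mat_ball_carrier: "X \<in> mat_ball mnormV m \<Longrightarrow> X \<in> carrier_mat m m"
  by (simp add: mat_ball_def)

lemma mat_ball_one: "x \<in> ball 0 1 \<Longrightarrow> mat 1 1 (\<lambda>_. x) \<in> mat_ball mnormV 1"
  by (simp add: mat_ball_def V.norm_eq)

lemma Hcb_eq_0: "f \<in> H \<Longrightarrow> x \<notin> ball 0 1 \<Longrightarrow> f x = 0"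
  by (simp add: Hcb_def)

lemma Hcb_frechet: "f \<in> H \<Longrightarrow> frechet_holomorphic_on scaleV scaleW f (ball 0 1)"
  by (simp add: Hcb_def)

lemma Hcb_bounded:
  assumes "f \<in> H"
  obtains B where "\<And>m X. 0 < m \<Longrightarrow> X \<in> mat_ball mnormV m \<Longrightarrow> mnormW (map_mat f X) \<le> B"
  using assms unfolding Hcb_def bdd_above_def by blast

lemma HcbI:
  assumes "\<And>x. x \<notin> ball 0 1 \<Longrightarrow> f x = 0" "frechet_holomorphic_on scaleV scaleW f (ball 0 1)"
    and "\<And>m X. 0 < m \<Longrightarrow> X \<in> mat_ball mnormV m \<Longrightarrow> mnormW (map_mat f X) \<le> B"
  shows "f \<in> H"
  using assms unfolding Hcb_def bdd_above_def by blast

lemma map_mat_add: "map_mat (f + g) X = map_mat f X + map_mat g X"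
  by (rule eq_matI) auto

lemma map_mat_fun_scale: "map_mat (fun_scale scaleW c f) X = map_mat (scaleW c) (map_mat f X)"
  by (rule eq_matI) (auto simp: fun_scale_def)

sublocale F: vector_space "fun_scale scaleW :: complex \<Rightarrow> ('v \<Rightarrow> 'w) \<Rightarrow> 'v \<Rightarrow> 'w"
  by (rule vector_space_fun_scale[OF W.vector_space_axioms])

sublocale VW: vector_space_pair scaleV scaleW ..

section \<open>Linear structure of the function space\<close>

lemma subspace_Hcb: "F.subspace H"
proof (rule F.subspaceI)
  show "0 \<in> H"
  proof (rule HcbI)
    have "Vector_Spaces.linear scaleV scaleW (\<lambda>_. 0)" by (rule VW.linear_zero)
    then show "frechet_holomorphic_on scaleV scaleW 0 (ball 0 1)"
      unfolding frechet_holomorphic_on_def zero_fun_def by (auto intro!: exI[of _ "\<lambda>_. 0"])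
    fix m X assume m: "0 < m" and X: "X \<in> mat_ball mnormV m"
    have "map_mat (0 :: 'v \<Rightarrow> 'w) X = 0\<^sub>m m m" using mat_ball_carrier[OF X] by (intro eq_matI) auto
    then show "mnormW (map_mat 0 X) \<le> 0" using W.mnorm_eq_0_iff[OF m, of "0\<^sub>m m m"] by simp
  qed simp
next
  fix f g assume f: "f \<in> H" and g: "g \<in> H"
  obtain B B' where B: "\<And>m X. 0 < m \<Longrightarrow> X \<in> mat_ball mnormV m \<Longrightarrow> mnormW (map_mat f X) \<le> B"
    and B': "\<And>m X. 0 < m \<Longrightarrow> X \<in> mat_ball mnormV m \<Longrightarrow> mnormW (map_mat g X) \<le> B'"
    using Hcb_bounded[OF f] Hcb_bounded[OF g] by metis
  show "f + g \<in> H"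
  proof (rule HcbI)
    show "(f + g) x = 0" if "x \<notin> ball 0 1" for x
      using Hcb_eq_0[OF f that] Hcb_eq_0[OF g that] by simp
    show "frechet_holomorphic_on scaleV scaleW (f + g) (ball 0 1)"
      unfolding frechet_holomorphic_on_def plus_fun_def
    proof
      fix x :: 'v assume "x \<in> ball 0 1"
      then obtain D E where "Vector_Spaces.linear scaleV scaleW D" "(f has_derivative D) (at x)"
        "Vector_Spaces.linear scaleV scaleW E" "(g has_derivative E) (at x)"
        using Hcb_frechet[OF f] Hcb_frechet[OF g] unfolding frechet_holomorphic_on_def by metis
      then show "\<exists>D. Vector_Spaces.linear scaleV scaleW D \<and> ((\<lambda>x. f x + g x) has_derivative D) (at x)"
        by (intro exI[of _ "\<lambda>h. D h + E h"] conjI VW.linear_compose_add has_derivative_add)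
    qed
    fix m X assume m: "0 < m" and X: "X \<in> mat_ball mnormV m"
    have "mnormW (map_mat (f + g) X) \<le> mnormW (map_mat f X) + mnormW (map_mat g X)"
      unfolding map_mat_add using mat_ball_carrier[OF X] by (intro W.mnorm_triangle[OF m]) auto
    then show "mnormW (map_mat (f + g) X) \<le> B + B'" using B[OF m X] B'[OF m X] by simp
  qed
next
  fix c f assume f: "f \<in> H"
  obtain B where B: "\<And>m X. 0 < m \<Longrightarrow> X \<in> mat_ball mnormV m \<Longrightarrow> mnormW (map_mat f X) \<le> B"
    using Hcb_bounded[OF f] by metis
  show "fun_scale scaleW c f \<in> H"
  proof (rule HcbI)
    show "fun_scale scaleW c f x = 0" if "x \<notin> ball 0 1" for x
      using Hcb_eq_0[OF f that] by (simp add: fun_scale_def)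
    show "frechet_holomorphic_on scaleV scaleW (fun_scale scaleW c f) (ball 0 1)"
      unfolding frechet_holomorphic_on_def fun_scale_def
    proof
      fix x :: 'v assume "x \<in> ball 0 1"
      then obtain D where "Vector_Spaces.linear scaleV scaleW D" "(f has_derivative D) (at x)"
        using Hcb_frechet[OF f] unfolding frechet_holomorphic_on_def by metis
      then show "\<exists>D. Vector_Spaces.linear scaleV scaleW D \<and>
          ((\<lambda>x. scaleW c (f x)) has_derivative D) (at x)"
        by (intro exI[of _ "\<lambda>h. scaleW c (D h)"] conjI VW.linear_compose_scale_right
            bounded_linear.has_derivative[OF W.bounded_linear_smul])
    qed
    fix m X assume m: "0 < m" and X: "X \<in> mat_ball mnormV m"
    have "mnormW (map_mat (fun_scale scaleW c f) X) = cmod c * mnormW (map_mat f X)"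
      unfolding map_mat_fun_scale using mat_ball_carrier[OF X] by (intro W.mnorm_scale[OF m]) auto
    also have "\<dots> \<le> cmod c * B" using B[OF m X] by (intro mult_left_mono) auto
    finally show "mnormW (map_mat (fun_scale scaleW c f) X) \<le> cmod c * B" .
  qed
qed

section \<open>Finite suprema and the matrix norm axioms\<close>

lemma bdd_above_Hcb_values:
  assumes n: "0 < n" and F: "F \<in> mats n H"
  shows "bdd_above (Hcb_values mnormV mnormW F)"
proof -
  have "\<exists>B. \<forall>m X. 0 < m \<longrightarrow> X \<in> mat_ball mnormV m \<longrightarrow> mnormW (map_mat f X) \<le> B" if "f \<in> H" for f
    using Hcb_bounded[OF that] by metis
  then obtain B where
    B: "\<And>f m X. f \<in> H \<Longrightarrow> 0 < m \<Longrightarrow> X \<in> mat_ball mnormV m \<Longrightarrow> mnormW (map_mat f X) \<le> B f"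
    by metis
  \<comment> \<open>The bound of each entry holds for all sizes m, so their sum over the n^2 entries
    is one bound for every X.\<close>
  have "mnormW (amplify F X) \<le> (\<Sum>k<n. \<Sum>l<n. B (F $$ (k, l)))"
    if m: "0 < m" and X: "X \<in> mat_ball mnormV m" for m X
  proof -
    have "mnormW (amplify F X) \<le> (\<Sum>k<n. \<Sum>l<n. mnormW (map_mat (F $$ (k, l)) X))"
      by (rule W.mnorm_amplify_le_sum[OF mats_carrier[OF F] mat_ball_carrier[OF X] n m])
    also have "\<dots> \<le> (\<Sum>k<n. \<Sum>l<n. B (F $$ (k, l)))"
      by (intro sum_mono B[OF _ m X] mats_index[OF F]) auto
    finally show ?thesis .
  qed
  then show ?thesis by (auto simp: Hcb_values_def bdd_above_def)
qed

lemma Hcb_mnorm_upper: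
  "\<lbrakk>0 < n; F \<in> mats n H; 0 < m; X \<in> mat_ball mnormV m\<rbrakk> \<Longrightarrow>
    mnormW (amplify F X) \<le> Hcb_mnorm mnormV mnormW F"
  unfolding Hcb_mnorm_def by (rule cSup_upper[OF _ bdd_above_Hcb_values]) (auto simp: Hcb_values_def)

lemma Hcb_mnorm_least:
  assumes "\<And>m X. 0 < m \<Longrightarrow> X \<in> mat_ball mnormV m \<Longrightarrow> mnormW (amplify F X) \<le> B"
  shows "Hcb_mnorm mnormV mnormW F \<le> B"
  unfolding Hcb_mnorm_def
proof (rule cSup_least)
  \<comment> \<open>The zero vector keeps the supremum from being taken over the empty set.\<close>
  have "mat 1 1 (\<lambda>_. 0) \<in> mat_ball mnormV 1" by (rule mat_ball_one) simp
  then show "Hcb_values mnormV mnormW F \<noteq> {}" unfolding Hcb_values_def by blast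
qed (use assms in \<open>auto simp: Hcb_values_def\<close>)

lemma Hcb_mnorm_nonneg:
  assumes n: "0 < n" and F: "F \<in> mats n H"
  shows "0 \<le> Hcb_mnorm mnormV mnormW F"
proof -
  let ?X = "mat 1 1 (\<lambda>_. 0) :: 'v mat"
  have "0 \<le> mnormW (amplify F ?X)"
    using n amplify_carrier[OF mats_carrier[OF F], of ?X 1 1] by (intro W.mnorm_nonneg[of n]) auto
  also have "\<dots> \<le> Hcb_mnorm mnormV mnormW F"
    by (rule Hcb_mnorm_upper[OF n F _ mat_ball_one]) auto
  finally show ?thesis .
qed

text \<open>Matrices X of size one already separate points: they recover the value of every entry of
  F in the ball. Off the ball the entries vanish by convention, so they are zero as total
  functions.\<close>

lemma Hcb_mnorm_eq_0_iff:
  assumes n: "0 < n" and F: "F \<in> mats n H"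
  shows "Hcb_mnorm mnormV mnormW F = 0 \<longleftrightarrow> F = 0\<^sub>m n n"
proof
  assume 0: "Hcb_mnorm mnormV mnormW F = 0"
  have Fc: "F \<in> carrier_mat n n" by (rule mats_carrier[OF F])
  show "F = 0\<^sub>m n n"
  proof (rule eq_matI)
    fix k l assume "k < dim_row (0\<^sub>m n n :: ('v \<Rightarrow> 'w) mat)" "l < dim_col (0\<^sub>m n n :: ('v \<Rightarrow> 'w) mat)"
    then have kl: "k < n" "l < n" by auto
    have "(F $$ (k, l)) x = 0" for x
    proof (cases "x \<in> ball 0 1")
      case True
      let ?X = "mat 1 1 (\<lambda>_. x)"
      have A: "amplify F ?X \<in> carrier_mat n n" using amplify_carrier[OF Fc, of ?X 1 1] by simp
      have "mnormW (amplify F ?X) \<le> 0"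
        using Hcb_mnorm_upper[OF n F zero_less_one_nat mat_ball_one[OF True]] 0 by simp
      moreover have "0 \<le> mnormW (amplify F ?X)" using A by (intro W.mnorm_nonneg[OF n]) auto
      ultimately have "mnormW (amplify F ?X) = 0" by (rule antisym)
      then have "amplify F ?X = 0\<^sub>m n n" using W.mnorm_eq_0_iff[OF n, of "amplify F ?X"] A by simp
      then have "amplify F ?X $$ (k, l) = 0" using kl by simp
      then show ?thesis using kl Fc by (simp add: amplify_def)
    next
      case False
      then show ?thesis by (rule Hcb_eq_0[OF mats_index[OF F kl]])
    qed
    then show "F $$ (k, l) = 0\<^sub>m n n $$ (k, l)" using kl by (auto simp: fun_eq_iff)
  qed (use Fc in auto)
next
  assume F0: "F = 0\<^sub>m n n"
  have "mnormW (amplify F X) \<le> 0" if m: "0 < m" and X: "X \<in> mat_ball mnormV m" for m X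
  proof -
    have "amplify F X = 0\<^sub>m (n * m) (n * m)"
      using mat_ball_carrier[OF X] by (intro eq_matI) (auto simp: F0 amplify_def div_mod_less)
    then show ?thesis using W.mnorm_eq_0_iff[of "n * m" "0\<^sub>m (n * m) (n * m)"] n m by simp
  qed
  from Hcb_mnorm_least[OF this] Hcb_mnorm_nonneg[OF n F]
  show "Hcb_mnorm mnormV mnormW F = 0" by simp
qed

lemma Hcb_mnorm_triangle:
  assumes n: "0 < n" and F: "F \<in> mats n H" and G: "G \<in> mats n H"
  shows "Hcb_mnorm mnormV mnormW (F + G) \<le> Hcb_mnorm mnormV mnormW F + Hcb_mnorm mnormV mnormW G"
proof (rule Hcb_mnorm_least)
  fix m X assume m: "0 < m" and X: "X \<in> mat_ball mnormV m"
  note c = mats_carrier[OF F] mats_carrier[OF G] mat_ball_carrier[OF X]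
  have "mnormW (amplify (F + G) X) \<le> mnormW (amplify F X) + mnormW (amplify G X)"
    unfolding amplify_add[OF c] using c n m by (intro W.mnorm_triangle[of "n * m"]) auto
  also have "\<dots> \<le> Hcb_mnorm mnormV mnormW F + Hcb_mnorm mnormV mnormW G"
    using n F G m X by (intro add_mono Hcb_mnorm_upper)
  finally show "mnormW (amplify (F + G) X) \<le>
      Hcb_mnorm mnormV mnormW F + Hcb_mnorm mnormV mnormW G" .
qed

lemma mats_Hcb_scale: "F \<in> mats n H \<Longrightarrow> map_mat (fun_scale scaleW c) F \<in> mats n H"
proof (rule matsI)
  assume F: "F \<in> mats n H"
  show "map_mat (fun_scale scaleW c) F \<in> carrier_mat n n" using mats_carrier[OF F] by simp
  show "map_mat (fun_scale scaleW c) F $$ (k, l) \<in> H" if "k < n" "l < n" for k l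
    using that mats_carrier[OF F] F.subspace_scale[OF subspace_Hcb mats_index[OF F that]] by simp
qed

lemma Hcb_mnorm_scale:
  assumes n: "0 < n" and F: "F \<in> mats n H"
  shows "Hcb_mnorm mnormV mnormW (map_mat (fun_scale scaleW c) F) = cmod c * Hcb_mnorm mnormV mnormW F"
proof -
  \<comment> \<open>Stated for arbitrary c and F because the reverse inequality applies it with 1 /
    c to the already scaled matrix.\<close>
  have le: "Hcb_mnorm mnormV mnormW (map_mat (fun_scale scaleW c) F) \<le>
      cmod c * Hcb_mnorm mnormV mnormW F" if F: "F \<in> mats n H" for c F
  proof (rule Hcb_mnorm_least)
    fix m X assume m: "0 < m" and X: "X \<in> mat_ball mnormV m"
    note c = mats_carrier[OF F] mat_ball_carrier[OF X]
    have "mnormW (amplify (map_mat (fun_scale scaleW c) F) X) = cmod c * mnormW (amplify F X)"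
      unfolding amplify_map[OF c] using c n m by (intro W.mnorm_scale[of "n * m"]) auto
    also have "\<dots> \<le> cmod c * Hcb_mnorm mnormV mnormW F"
      by (intro mult_left_mono Hcb_mnorm_upper[OF n F m X]) auto
    finally show "mnormW (amplify (map_mat (fun_scale scaleW c) F) X) \<le>
      cmod c * Hcb_mnorm mnormV mnormW F" .
  qed
  show ?thesis
  proof (cases "c = 0")
    case True
    then show ?thesis using le[OF F, of c] Hcb_mnorm_nonneg[OF n mats_Hcb_scale[OF F, of c]] by simp
  next
    case False
    have "map_mat (fun_scale scaleW (1 / c)) (map_mat (fun_scale scaleW c) F) = F"
      using False by (intro eq_matI) auto
    then have "Hcb_mnorm mnormV mnormW F \<le>
        cmod (1 / c) * Hcb_mnorm mnormV mnormW (map_mat (fun_scale scaleW c) F)"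
      using le[OF mats_Hcb_scale[OF F, of c], of "1 / c"] by simp
    then have "cmod c * Hcb_mnorm mnormV mnormW F \<le>
        Hcb_mnorm mnormV mnormW (map_mat (fun_scale scaleW c) F)"
      using False by (simp add: norm_divide field_simps)
    with le[OF F, of c] show ?thesis by simp
  qed
qed

lemma mats_Hcb_dsum:
  assumes F: "F \<in> mats n H" and G: "G \<in> mats n' H"
  shows "dsum_mat F G \<in> mats (n + n') H"
  by (rule matsI[OF dsum_carrier])
    (use mats_carrier[OF F] mats_carrier[OF G] in \<open>auto simp: dsum_index mats_index[OF F]
        mats_index[OF G] F.subspace_0[OF subspace_Hcb]\<close>)

lemma Hcb_mnorm_dsum:
  assumes n: "0 < n" "0 < n'" and F: "F \<in> mats n H" and G: "G \<in> mats n' H"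
  shows "Hcb_mnorm mnormV mnormW (dsum_mat F G) =
    max (Hcb_mnorm mnormV mnormW F) (Hcb_mnorm mnormV mnormW G)"
proof -
  have eq: "mnormW (amplify (dsum_mat F G) X) = max (mnormW (amplify F X)) (mnormW (amplify G X))"
    if m: "0 < m" and X: "X \<in> mat_ball mnormV m" for m X
  proof -
    note c = mats_carrier[OF F] mats_carrier[OF G] mat_ball_carrier[OF X]
    show ?thesis
      unfolding amplify_dsum[OF c] using c n m by (intro W.mnorm_dsum[of "n * m" "n' * m"]) auto
  qed
  have D: "mnormW (amplify (dsum_mat F G) X) \<le> Hcb_mnorm mnormV mnormW (dsum_mat F G)"
    if "0 < m" "X \<in> mat_ball mnormV m" for m X
    by (rule Hcb_mnorm_upper[OF _ mats_Hcb_dsum[OF F G] that]) (use n in simp)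
  show ?thesis
  proof (rule antisym)
    show "Hcb_mnorm mnormV mnormW (dsum_mat F G) \<le>
        max (Hcb_mnorm mnormV mnormW F) (Hcb_mnorm mnormV mnormW G)"
      using Hcb_mnorm_upper[OF n(1) F] Hcb_mnorm_upper[OF n(2) G]
      by (intro Hcb_mnorm_least) (auto simp: eq intro: max.coboundedI1 max.coboundedI2)
    show "max (Hcb_mnorm mnormV mnormW F) (Hcb_mnorm mnormV mnormW G) \<le>
        Hcb_mnorm mnormV mnormW (dsum_mat F G)"
      using D eq by (intro max.boundedI Hcb_mnorm_least) (metis max.bounded_iff)+
  qed
qed

lemma Hcb_mnorm_bimod:
  assumes pos: "0 < r" "0 < n" and \<alpha>: "\<alpha> \<in> carrier_mat n r" and F: "F \<in> mats r H"
    and \<beta>: "\<beta> \<in> carrier_mat r n"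
  shows "Hcb_mnorm mnormV mnormW (bimod_mult (fun_scale scaleW) \<alpha> F \<beta>) \<le>
    cmat_norm \<alpha> * Hcb_mnorm mnormV mnormW F * cmat_norm \<beta>"
proof (rule Hcb_mnorm_least)
  fix m X assume m: "0 < m" and X: "X \<in> mat_ball mnormV m"
  have "mnormW (amplify (bimod_mult (fun_scale scaleW) \<alpha> F \<beta>) X) \<le>
      cmat_norm \<alpha> * mnormW (amplify F X) * cmat_norm \<beta>"
    by (rule W.mnorm_amplify_bimod[OF pos(2,1) m mats_carrier[OF F] \<alpha> \<beta> mat_ball_carrier[OF X]])
  also have "\<dots> \<le> cmat_norm \<alpha> * Hcb_mnorm mnormV mnormW F * cmat_norm \<beta>"
    by (intro mult_right_mono mult_left_mono cmat_norm_nonneg Hcb_mnorm_upper[OF pos(1) F m X])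
  finally show "mnormW (amplify (bimod_mult (fun_scale scaleW) \<alpha> F \<beta>) X) \<le>
      cmat_norm \<alpha> * Hcb_mnorm mnormV mnormW F * cmat_norm \<beta>" .
qed

section \<open>Completeness\<close>

lemma mats_Hcb_one: "f \<in> H \<Longrightarrow> mat 1 1 (\<lambda>_. f) \<in> mats 1 H"
  by (rule matsI) auto

lemma Hcb_mnorm_one_upper:
  assumes "f \<in> H" "0 < m" "X \<in> mat_ball mnormV m"
  shows "mnormW (map_mat f X) \<le> Hcb_mnorm mnormV mnormW (mat 1 1 (\<lambda>_. f))"
  using Hcb_mnorm_upper[OF zero_less_one_nat mats_Hcb_one[OF assms(1)] assms(2,3)]
  by (simp only: amplify_one_by_one[OF mat_ball_carrier[OF assms(3)]])

lemma Hcb_mnorm_one_least: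
  assumes "\<And>m X. 0 < m \<Longrightarrow> X \<in> mat_ball mnormV m \<Longrightarrow> mnormW (map_mat f X) \<le> B"
  shows "Hcb_mnorm mnormV mnormW (mat 1 1 (\<lambda>_. f)) \<le> B"
  using assms by (intro Hcb_mnorm_least) (simp only: amplify_one_by_one[OF mat_ball_carrier])

text \<open>Turns a Cauchy sequence in the completely bounded norm into a uniformly Cauchy sequence
  of functions; x ranges over the whole space since f vanishes off the ball.\<close>

lemma norm_le_Hcb_mnorm:
  assumes f: "f \<in> H"
  shows "norm (f x) \<le> Hcb_mnorm mnormV mnormW (mat 1 1 (\<lambda>_. f))"
proof (cases "x \<in> ball 0 1")
  case True
  have "map_mat f (mat 1 1 (\<lambda>_. x)) = mat 1 1 (\<lambda>_. f x)" by (rule eq_matI) auto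
  then show ?thesis
    using Hcb_mnorm_one_upper[OF f zero_less_one_nat mat_ball_one[OF True]] by (simp add: W.norm_eq)
next
  case False
  then show ?thesis
    using Hcb_eq_0[OF f] Hcb_mnorm_nonneg[OF zero_less_one_nat mats_Hcb_one[OF f]] by simp
qed

text \<open>With X fixed there are m^2 entries, so pointwise convergence makes the error
  \<open>?s\<close> tend to 0. The bound B is preserved exactly, so a B chosen independently of m
  stays independent of m.\<close>

lemma mnorm_map_mat_limit_le:
  assumes lim: "\<And>x. (\<lambda>n. h n x) \<longlonglongrightarrow> h' x" and X: "X \<in> carrier_mat m m" and m: "0 < m"
    and bound: "\<And>n. N \<le> n \<Longrightarrow> mnormW (map_mat (h n) X) \<le> B"
  shows "mnormW (map_mat h' X) \<le> B"
proof (rule LIMSEQ_le_const)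
  let ?s = "\<lambda>n. \<Sum>i<m. \<Sum>j<m. norm (h' (X $$ (i, j)) - h n (X $$ (i, j)))"
  have "(\<lambda>n. B + ?s n) \<longlonglongrightarrow> B + (\<Sum>i<m. \<Sum>j<m. norm (h' (X $$ (i, j)) - h' (X $$ (i, j))))"
    by (intro tendsto_intros lim)
  then show "(\<lambda>n. B + ?s n) \<longlonglongrightarrow> B" by simp
  have "mnormW (map_mat h' X) \<le> B + ?s n" if "N \<le> n" for n
  proof -
    have "map_mat h' X = map_mat (h n) X + map_mat (h' - h n) X" by (rule eq_matI) auto
    then have "mnormW (map_mat h' X) \<le> mnormW (map_mat (h n) X) + mnormW (map_mat (h' - h n) X)"
      using W.mnorm_triangle[OF m, of "map_mat (h n) X" "map_mat (h' - h n) X"] X by simp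
    also have "mnormW (map_mat (h' - h n) X) \<le> ?s n"
      using W.mnorm_le_sum_norm[of "map_mat (h' - h n) X" m] X m by simp
    finally show ?thesis using bound[OF that] by simp
  qed
  then show "\<exists>N. \<forall>n\<ge>N. mnormW (map_mat h' X) \<le> B + ?s n" by blast
qed

text \<open>The pointwise limit g is controlled through the differences \<open>f k - g\<close>:
  letting l tend to infinity in the Cauchy condition bounds them at all matrix sizes. This serves
  both for membership in \<open>H\<close> and for norm convergence.\<close>

lemma Hcb_complete:
  assumes f: "\<And>k :: nat. f k \<in> H"
    and cauchy: "\<And>e. 0 < e \<Longrightarrow>
      \<exists>N. \<forall>k\<ge>N. \<forall>l\<ge>N. Hcb_mnorm mnormV mnormW (mat 1 1 (\<lambda>_. f k - f l)) < e"
  shows "\<exists>g\<in>H. (\<lambda>k. Hcb_mnorm mnormV mnormW (mat 1 1 (\<lambda>_. f k - g))) \<longlonglongrightarrow> 0"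
proof -
  have fd: "f k - f l \<in> H" for k l by (rule F.subspace_diff[OF subspace_Hcb f f])
  have cauchy': "\<exists>N. \<forall>k\<ge>N. \<forall>l\<ge>N. \<forall>x. norm (f k x - f l x) < e" if e: "0 < e" for e
  proof -
    have "norm (f k x - f l x) \<le> Hcb_mnorm mnormV mnormW (mat 1 1 (\<lambda>_. f k - f l))" for k l x
      using norm_le_Hcb_mnorm[OF fd, of k l x] by simp
    from le_less_trans[OF this] cauchy[OF e] show ?thesis by meson
  qed
  have "Cauchy (\<lambda>k. f k x)" for x
  proof (rule CauchyI)
    fix e :: real assume "0 < e"
    from cauchy'[OF this] show "\<exists>M. \<forall>m\<ge>M. \<forall>n\<ge>M. norm (f m x - f n x) < e" by meson
  qed
  then have "\<exists>y. (\<lambda>k. f k x) \<longlonglongrightarrow> y" for x by (simp add: Cauchy_convergent_iff convergent_def)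
  then obtain g where g: "\<And>x. (\<lambda>k. f k x) \<longlonglongrightarrow> g x" by metis
  have lim: "(\<lambda>l. (f k - f l) x) \<longlonglongrightarrow> (f k - g) x" for k x
    using tendsto_diff[OF tendsto_const g] by simp
  have est: "mnormW (map_mat (f k - g) X) \<le> e"
    if N: "\<And>k l. N \<le> k \<Longrightarrow> N \<le> l \<Longrightarrow> Hcb_mnorm mnormV mnormW (mat 1 1 (\<lambda>_. f k - f l)) < e"
      and k: "N \<le> k" and m: "0 < m" and X: "X \<in> mat_ball mnormV m" for N e k m X
  proof (rule mnorm_map_mat_limit_le[OF lim mat_ball_carrier[OF X] m])
    fix l assume "N \<le> l"
    from N[OF k this] show "mnormW (map_mat (f k - f l) X) \<le> e"
      using Hcb_mnorm_one_upper[OF fd m X, of k l] by simp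
  qed
  \<comment> \<open>The value 1 is arbitrary: any finite bound on one difference
    \<open>f N - g\<close> suffices for membership.\<close>
  obtain N where "\<And>k l. N \<le> k \<Longrightarrow> N \<le> l \<Longrightarrow> Hcb_mnorm mnormV mnormW (mat 1 1 (\<lambda>_. f k - f l)) < 1"
    using cauchy[of 1] by auto
  note bound = est[OF this order_refl]
  have "f N - g \<in> H"
  proof (rule HcbI)
    show "(f N - g) x = 0" if "x \<notin> ball 0 1" for x
    proof -
      have "(\<lambda>l. (f N - f l) x) = (\<lambda>_. 0)" by (rule ext) (rule Hcb_eq_0[OF fd that])
      with lim[of N x] show ?thesis by (simp only: LIMSEQ_const_iff)
    qed
    \<comment> \<open>The function \<open>f N - g\<close> is the uniform limit of
      \<open>f N - f l\<close> in l, with N held fixed.\<close>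
    show "frechet_holomorphic_on scaleV scaleW (f N - g) (ball 0 1)"
    proof (rule frechet_holomorphic_on_uniform_limit)
      show "frechet_holomorphic_on scaleV scaleW (f N - f l) (ball 0 1)" for l by (rule Hcb_frechet[OF fd])
      show "(\<lambda>l. (f N - f l) x) \<longlonglongrightarrow> (f N - g) x" for x by (rule lim)
      fix e :: real assume "0 < e"
      from cauchy'[OF this] obtain M where
        "\<And>k l x. M \<le> k \<Longrightarrow> M \<le> l \<Longrightarrow> norm (f k x - f l x) < e" by blast
      then have "norm ((f N - f n) x - (f N - f m) x) \<le> e" if "M \<le> n" "M \<le> m" for n m x
        using that by (simp add: less_imp_le)
      then show "\<exists>M. \<forall>n\<ge>M. \<forall>m\<ge>M. \<forall>x\<in>ball 0 1. norm ((f N - f n) x - (f N - f m) x) \<le> e"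
        by blast
    qed
  qed (rule bound)
  \<comment> \<open>The subspace property recovers g from the difference.\<close>
  then have "f N - (f N - g) \<in> H" by (rule F.subspace_diff[OF subspace_Hcb f])
  then have gH: "g \<in> H" by simp
  have "(\<lambda>k. Hcb_mnorm mnormV mnormW (mat 1 1 (\<lambda>_. f k - g))) \<longlonglongrightarrow> 0"
  proof (rule LIMSEQ_I)
    fix e :: real assume "0 < e"
    \<comment> \<open>The limit in l keeps only a weak inequality, so half of e leaves room for the
      strict one.\<close>
    then have "0 < e / 2" by simp
    from cauchy[OF this] obtain M where
      M: "\<And>k l. M \<le> k \<Longrightarrow> M \<le> l \<Longrightarrow> Hcb_mnorm mnormV mnormW (mat 1 1 (\<lambda>_. f k - f l)) < e / 2"
      by blast
    have "norm (Hcb_mnorm mnormV mnormW (mat 1 1 (\<lambda>_. f k - g)) - 0) < e" if "M \<le> k" for k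
    proof -
      have "Hcb_mnorm mnormV mnormW (mat 1 1 (\<lambda>_. f k - g)) \<le> e / 2"
        by (rule Hcb_mnorm_one_least) (rule est[OF M that])
      moreover have "0 \<le> Hcb_mnorm mnormV mnormW (mat 1 1 (\<lambda>_. f k - g))"
        by (rule Hcb_mnorm_nonneg[OF zero_less_one_nat mats_Hcb_one[OF F.subspace_diff[OF subspace_Hcb f gH]]])
      ultimately show ?thesis using \<open>0 < e\<close> by simp
    qed
    then show "\<exists>M. \<forall>k\<ge>M. norm (Hcb_mnorm mnormV mnormW (mat 1 1 (\<lambda>_. f k - g)) - 0) < e" by blast
  qed
  with gH show ?thesis by blast
qed

lemma operator_space_Hcb: "operator_space (fun_scale scaleW) H (Hcb_mnorm mnormV mnormW)"
  by unfold_locales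
    (fact subspace_Hcb Hcb_mnorm_nonneg Hcb_mnorm_eq_0_iff Hcb_mnorm_triangle Hcb_mnorm_scale
      Hcb_mnorm_dsum Hcb_mnorm_bimod Hcb_complete)+

end

theorem lemma3p2:
  fixes scaleV :: "complex \<Rightarrow> 'v::banach \<Rightarrow> 'v" and mnormV :: "'v mat \<Rightarrow> real"
    and scaleW :: "complex \<Rightarrow> 'w::banach \<Rightarrow> 'w" and mnormW :: "'w mat \<Rightarrow> real"
  assumes "operator_space_type scaleV mnormV"
    and "operator_space_type scaleW mnormW"
  shows "(\<forall>n F. 0 < n \<and> F \<in> mats n (Hcb scaleV mnormV scaleW mnormW) \<longrightarrow>
             bdd_above (Hcb_values mnormV mnormW F)) \<and>
         operator_space (fun_scale scaleW) (Hcb scaleV mnormV scaleW mnormW)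
           (Hcb_mnorm mnormV mnormW)"
proof -
  interpret operator_space_pair scaleV mnormV scaleW mnormW
    using assms by (rule operator_space_pair.intro)
  show ?thesis
  proof (intro conjI allI impI)
    fix n F assume "0 < n \<and> F \<in> mats n H"
    then have "0 < n" "F \<in> mats n H" by (rule conjunct1, rule conjunct2)
    then show "bdd_above (Hcb_values mnormV mnormW F)" by (rule bdd_above_Hcb_values)
  qed (rule operator_space_Hcb)
qed

end
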